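(* Let $k\le \ell\le 2k-1$. A graph $G$ with $n$ vertices is a $(k,\ell)$-pebble-game graph that is $(k,\ell)$-tight if and only if $G$ has a proper $\ell\mathsf{T}k$ decomposition and has $kn-\ell$ edges.
   Context: A graph means a finite multigraph, possibly with loops. A graph is $(k,\ell)$-sparse if every subgraph with $n'$ vertices and $m'\ge1$ edges has $m'\le kn'-\ell$. It is $(k,\ell)$-tight if it is $(k,\ell)$-sparse with exactly $kn-\ell$ edges. An $\ell\mathsf{T}k$ decomposition of $G$ is a partition of $E(G)$ into the edge sets of $\ell$ trees $T_1,\dots,T_\ell$. The trees are subgraphs of $G$, not necessarily spanning, and a tree may be a single vertex. Every vertex of $G$ must lie in exactly $k$ of the trees. For a subgraph $G'=(V',E')$ of $G$, the tree-pieces of $G'$ are the connected components of the graphs $(V(T_j)\cap V',\,E(T_j)\cap E')$ for $j=1,\dots,\ell$, counted separately for each $j$. The decomposition is proper if every non-empty subgraph $G'$ of $G$ that has at least one edge or satisfies $\ell\le k$ has at least $\ell$ tree-pieces. The $(k,\ell)$-pebble game with colors is played on a fixed finite vertex set $V$. Its state is a directed multigraph $H$ on $V$ (loops allowed) together with pebbles, each having one of $k$ colors $c_1,\dots,c_k$. Each pebble lies on a vertex or on an edge, and every edge carries exactly one pebble. Initially $H$ has no edges and each vertex carries one pebble of each color. Moves: (add-edge) Let $v,w$ be vertices, not necessarily distinct, whose set $\{v,w\}$ carries at least $\ell+1$ pebbles in total, with $v$ carrying at least one pebble. Pick up a pebble from $v$, add the directed edge $vw$, and put that pebble on it. (pebble-slide)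 Let $w$ carry a pebble $p$ and let $vw$ be an edge. Replace $vw$ by $wv$, put the pebble from $vw$ onto $v$, and put $p$ on $wv$. $G$ is a $(k,\ell)$-pebble-game graph if it is the underlying undirected graph of some $H$ reachable from the initial configuration on $V(G)$ by finitely many moves. *)

theory Defs
  imports "Graph_Theory.Digraph" "HOL-Library.Multiset" "HOL-Library.Disjoint_Sets"
begin

text \<open>Finite undirected multigraphs. Edges are abstract names, so parallel edges are
  distinct names with the same ends; a loop at \<open>v\<close> has the singleton \<open>{v}\<close> as its set of
  ends. The value of \<^term>\<open>ends\<close> outside the edge set carries no meaning.\<close>

record ('v, 'e) mgraph =
  vertices :: "'v set"
  edges :: "'e set"
  ends :: "'e \<Rightarrow> 'v set"

definition multigraph :: "('v, 'e) mgraph \<Rightarrow> bool" where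
  "multigraph G \<longleftrightarrow>
     finite (vertices G) \<and> finite (edges G) \<and>
     (\<forall>e\<in>edges G. ends G e \<subseteq> vertices G \<and> (card (ends G e) = 1 \<or> card (ends G e) = 2))"

definition same_graph :: "('v, 'e) mgraph \<Rightarrow> ('v, 'e) mgraph \<Rightarrow> bool" where
  "same_graph G H \<longleftrightarrow>
     vertices G = vertices H \<and> edges G = edges H \<and> (\<forall>e\<in>edges G. ends G e = ends H e)"

definition mg_subgraph :: "('v, 'e) mgraph \<Rightarrow> ('v, 'e) mgraph \<Rightarrow> bool" where
  "mg_subgraph H G \<longleftrightarrow>
     multigraph H \<and> vertices H \<subseteq> vertices G \<and> edges H \<subseteq> edges G \<and>
     (\<forall>e\<in>edges H. ends H e = ends G e)"

definition sparse :: "nat \<Rightarrow> nat \<Rightarrow> ('v, 'e) mgraph \<Rightarrow> bool" where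
  "sparse k l G \<longleftrightarrow>
     (\<forall>G'. mg_subgraph G' G \<and> card (edges G') \<ge> 1 \<longrightarrow>
        int (card (edges G')) \<le> int k * int (card (vertices G')) - int l)"

definition tight :: "nat \<Rightarrow> nat \<Rightarrow> ('v, 'e) mgraph \<Rightarrow> bool" where
  "tight k l G \<longleftrightarrow>
     sparse k l G \<and>
     int (card (edges G)) = int k * int (card (vertices G)) - int l"

definition adjacent :: "('v, 'e) mgraph \<Rightarrow> 'v \<Rightarrow> 'v \<Rightarrow> bool" where
  "adjacent G u v \<longleftrightarrow> (\<exists>e\<in>edges G. ends G e = {u, v})"

definition conn_rel :: "('v, 'e) mgraph \<Rightarrow> ('v \<times> 'v) set" where
  "conn_rel G = {(u, v). u \<in> vertices G \<and> v \<in> vertices G \<and> (adjacent G)\<^sup>*\<^sup>* u v}"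

text \<open>A connected component is represented by its vertex set.\<close>

definition components :: "('v, 'e) mgraph \<Rightarrow> 'v set set" where
  "components G = vertices G // conn_rel G"

definition mg_connected :: "('v, 'e) mgraph \<Rightarrow> bool" where
  "mg_connected G \<longleftrightarrow>
     vertices G \<noteq> {} \<and> (\<forall>u\<in>vertices G. \<forall>v\<in>vertices G. (u, v) \<in> conn_rel G)"

text \<open>A cycle is given by its vertices and edges in cyclic order. Length 1 is a loop,
  length 2 a pair of parallel edges.\<close>

definition cycle :: "('v, 'e) mgraph \<Rightarrow> 'v list \<Rightarrow> 'e list \<Rightarrow> bool" where
  "cycle G vs es \<longleftrightarrow>
     es \<noteq> [] \<and> length vs = length es \<and> distinct vs \<and> distinct es \<and>
     set vs \<subseteq> vertices G \<and> set es \<subseteq> edges G \<and>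
     (\<forall>i<length es. ends G (es ! i) = {vs ! i, vs ! (Suc i mod length es)})"

definition tree :: "('v, 'e) mgraph \<Rightarrow> bool" where
  "tree G \<longleftrightarrow> multigraph G \<and> mg_connected G \<and> \<not> (\<exists>vs es. cycle G vs es)"

definition lTk_decomposition ::
    "nat \<Rightarrow> nat \<Rightarrow> ('v, 'e) mgraph \<Rightarrow> (nat \<Rightarrow> ('v, 'e) mgraph) \<Rightarrow> bool" where
  "lTk_decomposition k l G T \<longleftrightarrow>
     (\<forall>j<l. mg_subgraph (T j) G \<and> tree (T j)) \<and>
     (\<Union>j<l. edges (T j)) = edges G \<and>
     disjoint_family_on (\<lambda>j. edges (T j)) {..<l} \<and>
     (\<forall>v\<in>vertices G. card {j. j < l \<and> v \<in> vertices (T j)} = k)"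

definition graph_inter :: "('v, 'e) mgraph \<Rightarrow> ('v, 'e) mgraph \<Rightarrow> ('v, 'e) mgraph" where
  "graph_inter H G' =
     \<lparr> vertices = vertices H \<inter> vertices G', edges = edges H \<inter> edges G', ends = ends H \<rparr>"

definition num_tree_pieces ::
    "nat \<Rightarrow> (nat \<Rightarrow> ('v, 'e) mgraph) \<Rightarrow> ('v, 'e) mgraph \<Rightarrow> nat" where
  "num_tree_pieces l T G' = (\<Sum>j<l. card (components (graph_inter (T j) G')))"

definition proper_lTk_decomposition ::
    "nat \<Rightarrow> nat \<Rightarrow> ('v, 'e) mgraph \<Rightarrow> (nat \<Rightarrow> ('v, 'e) mgraph) \<Rightarrow> bool" where
  "proper_lTk_decomposition k l G T \<longleftrightarrow>
     lTk_decomposition k l G T \<and>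
     (\<forall>G'. mg_subgraph G' G \<and> vertices G' \<noteq> {} \<and> (edges G' \<noteq> {} \<or> l \<le> k) \<longrightarrow>
        num_tree_pieces l T G' \<ge> l)"

text \<open>A game state is a directed multigraph with the multiset of colours of the pebbles on
  each vertex and the colour of the one pebble on each arc; the colours are \<open>1, \<dots>, k\<close>.\<close>

record ('v, 'e) pebble_state = "('v, 'e) pre_digraph" +
  vertex_pebbles :: "'v \<Rightarrow> nat multiset"
  arc_pebble :: "'e \<Rightarrow> nat"

definition initial_state :: "nat \<Rightarrow> 'v set \<Rightarrow> ('v, 'e) pebble_state \<Rightarrow> bool" where
  "initial_state k V s \<longleftrightarrow>
     verts s = V \<and> arcs s = {} \<and> (\<forall>v\<in>V. vertex_pebbles s v = mset_set {1..k})"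

definition put_pebble :: "nat \<Rightarrow> 'v \<Rightarrow> ('v \<Rightarrow> nat multiset) \<Rightarrow> 'v \<Rightarrow> nat multiset" where
  "put_pebble c v P = P(v := add_mset c (P v))"

definition remove_pebble :: "nat \<Rightarrow> 'v \<Rightarrow> ('v \<Rightarrow> nat multiset) \<Rightarrow> 'v \<Rightarrow> nat multiset" where
  "remove_pebble c v P = P(v := P v - {#c#})"

text \<open>An arc keeps its name when a slide reverses it. In \<open>add_edge\<close> the sum ranges over the
  set \<open>{v, w}\<close>, so for a loop the pebbles on \<open>v\<close> count once.\<close>

inductive reachable ::
    "nat \<Rightarrow> nat \<Rightarrow> 'v set \<Rightarrow> ('v, 'e) pebble_state \<Rightarrow> bool"
  for k l :: nat and V :: "'v set" where
  initial: "initial_state k V s \<Longrightarrow> reachable k l V s"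
| add_edge:
    "\<lbrakk> reachable k l V s; v \<in> V; w \<in> V;
       (\<Sum>x\<in>{v, w}. size (vertex_pebbles s x)) \<ge> l + 1;
       c \<in># vertex_pebbles s v; e \<notin> arcs s \<rbrakk>
     \<Longrightarrow> reachable k l V
          (s\<lparr> arcs := insert e (arcs s),
              tail := (tail s)(e := v),
              head := (head s)(e := w),
              vertex_pebbles := remove_pebble c v (vertex_pebbles s),
              arc_pebble := (arc_pebble s)(e := c) \<rparr>)"
| pebble_slide:
    "\<lbrakk> reachable k l V s; e \<in> arcs s; tail s e = v; head s e = w;
       p \<in># vertex_pebbles s w \<rbrakk>
     \<Longrightarrow> reachable k l V
          (s\<lparr> tail := (tail s)(e := w),
              head := (head s)(e := v),
              vertex_pebbles :=
                put_pebble (arc_pebble s e) v (remove_pebble p w (vertex_pebbles s)),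
              arc_pebble := (arc_pebble s)(e := p) \<rparr>)"

definition underlying_graph :: "('v, 'e) pebble_state \<Rightarrow> ('v, 'e) mgraph" where
  "underlying_graph s =
     \<lparr> vertices = verts s, edges = arcs s, ends = (\<lambda>e. {tail s e, head s e}) \<rparr>"

definition pebble_game_graph :: "nat \<Rightarrow> nat \<Rightarrow> ('v, 'e) mgraph \<Rightarrow> bool" where
  "pebble_game_graph k l G \<longleftrightarrow>
     (\<exists>s. reachable k l (vertices G) s \<and> same_graph G (underlying_graph s))"

end

theory Submission
  imports Defs
begin

text \<open>A decomposition into \<open>\<ell>\<close> trees with every vertex in exactly \<open>k\<close> of them satisfies
  pieces \<open>= k n' - m'\<close> on every subgraph with \<open>n'\<close> vertices and \<open>m'\<close> edges, so properness is
  sparsity. Conversely, a \<open>(k, \<ell>)\<close>-tight graph with \<open>k \<le> \<ell>\<close> satisfies the condition of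
  Nash-Williams, hence is a union of \<open>k\<close> edge-disjoint forests; these have
  \<open>k n - (k n - \<ell>) = \<ell>\<close> components altogether, which are the required trees. The arboricity
  theorem itself is an instance of matroid partition. Finally, every sparse graph can be built by
  the pebble game, since sparsity leaves enough reachable pebbles to gather \<open>\<ell> + 1\<close> of them
  on the ends of the next edge.\<close>


subsection \<open>Matroid partition\<close>

text \<open>The arboricity bound is \<open>m' \<le> k (n' - 1)\<close> on nonempty vertex sets.
  Where an edge is induced it follows from \<open>m' \<le> k n' - l\<close> because
  \<open>k \<le> l\<close>; elsewhere \<open>m' = 0\<close>. The obstacle is the partition itself: a
  new edge may be spanned by all \<open>k\<close> forests at once, and then edges must be moved
  between them. Presenting the matroid by its closure operator suits this, since spanning in a graph
  is just connectivity. When no sequence of exchanges makes room, there is a set \<open>S\<close> of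
  edges containing the new one such that each forest spans all of \<open>S\<close> by its own
  members of \<open>S\<close>. Inside the component of the new edge in \<open>S\<close>, on
  \<open>n'\<close> vertices, the forests supply \<open>k\<close> disjoint sets of at least
  \<open>n' - 1\<close> edges each, and the new edge is one too many. In the game, the invariant
  that pebbles and outgoing arcs at a vertex add up to \<open>k\<close> has the corresponding task:
  it turns a shortage of fetchable pebbles into an excess of edges.\<close>

locale closure_matroid =
  fixes E :: "'e set" and cl :: "'e set \<Rightarrow> 'e set"
  assumes finite_ground: "finite E"
    and extensive: "X \<subseteq> E \<Longrightarrow> X \<subseteq> cl X"
    and closed: "\<lbrakk>X \<subseteq> E; Y \<subseteq> E; Y \<subseteq> cl X\<rbrakk> \<Longrightarrow> cl Y \<subseteq> cl X"
    and exchange: "\<lbrakk>X \<subseteq> E; e \<in> E; f \<in> E; e \<in> cl (insert f X); e \<notin> cl X\<rbrakk> \<Longrightarrow> f \<in> cl (insert e X)"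
begin

definition indep :: "'e set \<Rightarrow> bool" where
  "indep X \<longleftrightarrow> (\<forall>x\<in>X. x \<notin> cl (X - {x}))"

definition indep_partition :: "nat \<Rightarrow> (nat \<Rightarrow> 'e set) \<Rightarrow> 'e set \<Rightarrow> bool" where
  "indep_partition k T X \<longleftrightarrow>
     (\<forall>i<k. indep (T i)) \<and> disjoint_family_on T {..<k} \<and> (\<Union>i<k. T i) = X"

lemma mono: "X \<subseteq> Y \<Longrightarrow> Y \<subseteq> E \<Longrightarrow> cl X \<subseteq> cl Y"
  by (meson closed extensive order_trans)

lemma indep_subset: "indep Y \<Longrightarrow> X \<subseteq> Y \<Longrightarrow> Y \<subseteq> E \<Longrightarrow> indep X"
proof -
  assume *: "indep Y" "X \<subseteq> Y" "Y \<subseteq> E"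
  have "cl (X - {x}) \<subseteq> cl (Y - {x})" for x
    using * by (intro mono) auto
  then show "indep X" using * unfolding indep_def by blast
qed

text \<open>If some \<open>x\<close> in \<open>X\<close> became spanned once \<open>e\<close> is
  added, exchange would put \<open>e\<close> into the closure of \<open>X\<close>.\<close>

lemma indep_insert:
  assumes "indep X" "X \<subseteq> E" "e \<in> E" "e \<notin> cl X"
  shows "indep (insert e X)"
  unfolding indep_def
proof
  fix x assume x: "x \<in> insert e X"
  have eX: "e \<notin> X" using assms extensive by blast
  show "x \<notin> cl (insert e X - {x})"
  proof (cases "x = e")
    case True
    then show ?thesis using eX assms by simp
  next
    case False
    then have xX: "x \<in> X" using x by simp
    have eq: "insert e X - {x} = insert e (X - {x})" using False by blast
    have "x \<notin> cl (X - {x})" using assms xX by (simp add: indep_def)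
    then have "x \<in> cl (insert e (X - {x})) \<Longrightarrow> e \<in> cl (insert x (X - {x}))"
      using exchange[of "X - {x}" x e] assms xX by blast
    moreover have "insert x (X - {x}) = X" using xX by blast
    ultimately show ?thesis using eq assms(4) by auto
  qed
qed

text \<open>The set in the conclusion is the fundamental circuit of \<open>e\<close> with respect to \<open>X\<close>, without \<open>e\<close>.\<close>

lemma in_closure_of_fundamental_circuit:
  assumes "indep X" "X \<subseteq> E" "e \<in> E" "e \<in> cl X"
  shows "e \<in> cl {f \<in> X. e \<notin> cl (X - {f})}"
proof -
  have finX: "finite X" using assms(2) finite_ground finite_subset by blast
  \<comment> \<open>\<open>D\<close> is a minimal subset of \<open>X\<close> spanning
    \<open>e\<close>. If some \<open>f\<close> in \<open>D\<close> were dispensable in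
    \<open>X\<close>, exchange would span \<open>f\<close> by \<open>e\<close> and the rest of
    \<open>D\<close>, hence by \<open>X - {f}\<close>, against independence; so \<open>D\<close>
    lies in the fundamental circuit.\<close>
  obtain D where D: "D \<subseteq> X" "e \<in> cl D" and min: "\<And>D'. D' \<subset> D \<Longrightarrow> e \<notin> cl D'"
  proof -
    obtain D where "is_arg_min card (\<lambda>D. D \<subseteq> X \<and> e \<in> cl D) D"
      using assms(4) ex_has_least_nat[of "\<lambda>D. D \<subseteq> X \<and> e \<in> cl D" X card]
      by (auto simp: is_arg_min_linorder)
    then show ?thesis
      using that[of D] finX unfolding is_arg_min_def
      by (metis finite_subset order_trans psubset_card_mono psubset_imp_subset)
  qed
  have "e \<notin> cl (X - {f})" if f: "f \<in> D" for f
  proof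
    assume e: "e \<in> cl (X - {f})"
    have "e \<notin> cl (D - {f})" using min f by blast
    moreover have "insert f (D - {f}) = D" using f by blast
    ultimately have "f \<in> cl (insert e (D - {f}))"
      using exchange[of "D - {f}" e f] D f assms by auto
    moreover have "cl (insert e (D - {f})) \<subseteq> cl (X - {f})"
    proof (rule closed)
      have "X - {f} \<subseteq> cl (X - {f})" using assms(2) by (intro extensive) blast
      then show "insert e (D - {f}) \<subseteq> cl (X - {f})" using e D by blast
    qed (use assms D in auto)
    ultimately show False using assms(1) D f by (auto simp: indep_def)
  qed
  then have "D \<subseteq> {f \<in> X. e \<notin> cl (X - {f})}" using D by blast
  then show ?thesis using D(2) mono assms(2) by blast
qed

text \<open>Augmenting sequences as states: \<open>T\<close> covers everything except one element
  \<open>e\<close>. A swap lets part \<open>i\<close> take \<open>e\<close> and give up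
  \<open>f\<close>, under exactly the condition that keeps the part independent. Updating the
  partition after every exchange avoids shortest augmenting paths in a fixed exchange graph.\<close>

inductive uncovers :: "nat \<Rightarrow> (nat \<Rightarrow> 'e set) \<Rightarrow> 'e \<Rightarrow> (nat \<Rightarrow> 'e set) \<Rightarrow> 'e \<Rightarrow> bool"
  for k T\<^sub>0 e\<^sub>0 where
  start: "uncovers k T\<^sub>0 e\<^sub>0 T\<^sub>0 e\<^sub>0"
| swap: "\<lbrakk>uncovers k T\<^sub>0 e\<^sub>0 T e; i < k; f \<in> T i; e \<notin> cl (T i - {f})\<rbrakk> \<Longrightarrow>
    uncovers k T\<^sub>0 e\<^sub>0 (T(i := insert e (T i - {f}))) f"

lemma uncovers_indep_partition:
  assumes "uncovers k T\<^sub>0 e\<^sub>0 T e" "indep_partition k T\<^sub>0 X" "e\<^sub>0 \<notin> X" "insert e\<^sub>0 X \<subseteq> E"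
  shows "e \<in> insert e\<^sub>0 X \<and> indep_partition k T (insert e\<^sub>0 X - {e})"
  using assms
proof (induction rule: uncovers.induct)
  case start
  then show ?case by simp
next
  case (swap T e i f)
  let ?T = "T(i := insert e (T i - {f}))"
  have e: "e \<in> insert e\<^sub>0 X" and P: "indep_partition k T (insert e\<^sub>0 X - {e})"
    using swap by auto
  have Ti: "indep (T i)" "T i \<subseteq> insert e\<^sub>0 X - {e}"
    using P swap.hyps by (auto simp: indep_partition_def)
  have f: "f \<in> insert e\<^sub>0 X" "f \<noteq> e" using Ti swap.hyps by auto
  have ind: "indep (insert e (T i - {f}))"
    using Ti swap.hyps swap.prems e
    by (intro indep_insert indep_subset[OF Ti(1)]) auto
  have disj: "T a \<inter> T b = {}" if "a < k" "b < k" "a \<noteq> b" for a b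
    using P that by (auto simp: indep_partition_def disjoint_family_on_def)
  have un: "(\<Union>j<k. T j) = insert e\<^sub>0 X - {e}" using P by (simp add: indep_partition_def)
  have "disjoint_family_on ?T {..<k}"
    unfolding disjoint_family_on_def
  proof (intro ballI impI)
    fix a b assume ab: "a \<in> {..<k}" "b \<in> {..<k}" "a \<noteq> b"
    then show "?T a \<inter> ?T b = {}" using disj[of a b] un by auto
  qed
  moreover have "(\<Union>j<k. ?T j) = insert e\<^sub>0 X - {f}"
  proof -
    have "f \<notin> ?T j" if "j < k" for j
      using that disj[of i j] swap.hyps f by (cases "j = i") auto
    moreover have "?T j \<subseteq> insert e\<^sub>0 X" if "j < k" for j
      using un that e by auto
    moreover have "x \<in> (\<Union>j<k. ?T j)" if "x \<in> insert e\<^sub>0 X - {f}" for x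
    proof (cases "x = e")
      case True
      then have "x \<in> ?T i" by simp
      then show ?thesis using swap.hyps(2) by blast
    next
      case False
      then have "x \<in> (\<Union>j<k. T j)" using that unfolding un by simp
      then obtain j where "j < k" "x \<in> T j" by blast
      then have "x \<in> ?T j" using that by auto
      then show ?thesis using \<open>j < k\<close> by blast
    qed
    ultimately show ?thesis by blast
  qed
  moreover have "\<forall>j<k. indep (?T j)"
    using ind P by (simp add: indep_partition_def)
  ultimately show ?case
    using f(1) unfolding indep_partition_def by blast
qed

text \<open>If no sequence of swaps leads to an augmentation, the elements that can be left over by
  some sequence form the set \<open>S\<close>: a swap inserts an element that \<open>T i \<inter> S\<close> already spans,
  so the closures of the sets \<open>T i \<inter> S\<close> never grow.\<close>

lemma augment_or_spanned:
  assumes T0: "indep_partition k T\<^sub>0 X" and e0: "e\<^sub>0 \<notin> X" and sub: "insert e\<^sub>0 X \<subseteq> E"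
  shows "(\<exists>T. indep_partition k T (insert e\<^sub>0 X)) \<or>
    (\<exists>S. S \<subseteq> insert e\<^sub>0 X \<and> e\<^sub>0 \<in> S \<and> (\<forall>i<k. S \<subseteq> cl (T\<^sub>0 i \<inter> S)))"
proof (cases "\<exists>T e i. uncovers k T\<^sub>0 e\<^sub>0 T e \<and> i < k \<and> e \<notin> cl (T i)")
  case True
  then obtain T e i where u: "uncovers k T\<^sub>0 e\<^sub>0 T e" "i < k" "e \<notin> cl (T i)" by blast
  have e: "e \<in> insert e\<^sub>0 X" and P: "indep_partition k T (insert e\<^sub>0 X - {e})"
    using uncovers_indep_partition[OF u(1) T0 e0 sub] by auto
  have un: "(\<Union>j<k. T j) = insert e\<^sub>0 X - {e}" using P by (simp add: indep_partition_def)
  let ?T = "T(i := insert e (T i))"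
  have "indep (insert e (T i))"
    using u P un e sub by (intro indep_insert) (auto simp: indep_partition_def)
  moreover have "disjoint_family_on ?T {..<k}"
    unfolding disjoint_family_on_def
  proof (intro ballI impI)
    fix a b assume ab: "a \<in> {..<k}" "b \<in> {..<k}" "a \<noteq> b"
    then have "T a \<inter> T b = {}" using P by (auto simp: indep_partition_def disjoint_family_on_def)
    then show "?T a \<inter> ?T b = {}" using ab un by auto
  qed
  moreover have "(\<Union>j<k. ?T j) = insert e\<^sub>0 X"
  proof -
    have "(\<Union>j<k. ?T j) = insert e (\<Union>j<k. T j)"
      using u(2) by (auto split: if_splits)
    then show ?thesis using un e by auto
  qed
  ultimately have "indep_partition k ?T (insert e\<^sub>0 X)"
    using P by (simp add: indep_partition_def)
  then show ?thesis by blast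
next
  case False
  define S where "S = {e. \<exists>T. uncovers k T\<^sub>0 e\<^sub>0 T e}"
  have inv: "e \<in> insert e\<^sub>0 X" "\<And>i. i < k \<Longrightarrow> indep (T i)" "\<And>i. i < k \<Longrightarrow> T i \<subseteq> E"
    if "uncovers k T\<^sub>0 e\<^sub>0 T e" for T e
    using uncovers_indep_partition[OF that T0 e0 sub] sub
    unfolding indep_partition_def by blast+
  \<comment> \<open>Each element of the fundamental circuit of \<open>e\<close> in
    \<open>T i\<close> can be the next one left over, so the part of that circuit in
    \<open>T i\<close> lies in \<open>S\<close>.\<close>
  have spanned: "e \<in> cl (T i \<inter> S)" if u: "uncovers k T\<^sub>0 e\<^sub>0 T e" and i: "i < k" for T e i
  proof -
    have "e \<in> cl {f \<in> T i. e \<notin> cl (T i - {f})}"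
      using False u i inv[OF u] sub by (intro in_closure_of_fundamental_circuit) blast+
    moreover have "{f \<in> T i. e \<notin> cl (T i - {f})} \<subseteq> T i \<inter> S"
      using uncovers.swap[OF u i] unfolding S_def by blast
    ultimately show ?thesis using mono[of _ "T i \<inter> S"] inv(3)[OF u i] by blast
  qed
  have shrink: "cl (T i \<inter> S) \<subseteq> cl (T\<^sub>0 i \<inter> S)" if "uncovers k T\<^sub>0 e\<^sub>0 T e" "i < k" for T e i
    using that
  proof (induction rule: uncovers.induct)
    case start
    then show ?case by simp
  next
    case (swap T e j f)
    show ?case
    proof (cases "j = i")
      case True
      have sE: "T i \<inter> S \<subseteq> E" using inv(3)[OF swap.hyps(1) swap.prems] by blast
      have "insert e (T i - {f}) \<inter> S \<subseteq> cl (T i \<inter> S)"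
        using spanned[OF swap.hyps(1) swap.prems] extensive[OF sE] by blast
      moreover have "insert e (T i - {f}) \<inter> S \<subseteq> E"
        using inv[OF swap.hyps(1)] swap.prems sub by blast
      ultimately have "cl (insert e (T i - {f}) \<inter> S) \<subseteq> cl (T i \<inter> S)"
        using closed[OF sE] by blast
      then show ?thesis using True swap by auto
    qed (use swap in auto)
  qed
  have "S \<subseteq> insert e\<^sub>0 X" using inv(1) unfolding S_def by blast
  moreover have "e\<^sub>0 \<in> S" unfolding S_def using uncovers.start by blast
  moreover have "S \<subseteq> cl (T\<^sub>0 i \<inter> S)" if "i < k" for i
    using spanned shrink that unfolding S_def by blast
  ultimately show ?thesis by blast
qed

end

subsection \<open>Forests and arboricity\<close>

text \<open>Stated for an ends function and a bare edge set instead of a graph, because the matroid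
  arguments vary only the edge set.\<close>

definition linked :: "('e \<Rightarrow> 'v set) \<Rightarrow> 'e set \<Rightarrow> 'v \<Rightarrow> 'v \<Rightarrow> bool" where
  "linked en F = (\<lambda>u v. \<exists>e\<in>F. en e = {u, v})\<^sup>*\<^sup>*"

text \<open>Closure in the graphic matroid. It ranges over all names of the type, so it may contain
  names outside the ground set; the axioms of \<open>closure_matroid\<close> permit this.\<close>

definition edge_closure :: "('e \<Rightarrow> 'v set) \<Rightarrow> 'e set \<Rightarrow> 'e set" where
  "edge_closure en F = {e. \<exists>u v. en e = {u, v} \<and> linked en F u v}"

text \<open>Independence in the graphic matroid. As \<open>linked\<close> is reflexive, a loop is
  spanned by every set, so an acyclic set contains no loop.\<close>

definition acyclic_edges :: "('e \<Rightarrow> 'v set) \<Rightarrow> 'e set \<Rightarrow> bool" where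
  "acyclic_edges en F \<longleftrightarrow> (\<forall>f\<in>F. f \<notin> edge_closure en (F - {f}))"

definition linked_rel :: "('e \<Rightarrow> 'v set) \<Rightarrow> 'e set \<Rightarrow> 'v set \<Rightarrow> ('v \<times> 'v) set" where
  "linked_rel en F V = {(u, v). u \<in> V \<and> v \<in> V \<and> linked en F u v}"

lemma linked_refl: "linked en F u u"
  by (simp add: linked_def)

lemma linked_sym: "linked en F u v \<Longrightarrow> linked en F v u"
proof -
  have "symp (\<lambda>u v. \<exists>e\<in>F. en e = {u, v})"
    by (auto intro!: sympI simp: insert_commute)
  then show "linked en F u v \<Longrightarrow> linked en F v u"
    unfolding linked_def by (meson symp_rtranclp sympD)
qed

lemma linked_trans: "linked en F u v \<Longrightarrow> linked en F v w \<Longrightarrow> linked en F u w"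
  unfolding linked_def by (rule rtranclp_trans)

lemma linked_edge: "e \<in> F \<Longrightarrow> en e = {u, v} \<Longrightarrow> linked en F u v"
  unfolding linked_def by (rule r_into_rtranclp) blast

lemma edge_closure_iff: "en e = {u, v} \<Longrightarrow> e \<in> edge_closure en F \<longleftrightarrow> linked en F u v"
  unfolding edge_closure_def by (auto simp: doubleton_eq_iff intro: linked_sym)

lemma linked_closed:
  assumes "Y \<subseteq> edge_closure en X" "linked en Y u v"
  shows "linked en X u v"
  using assms(2) unfolding linked_def[of en Y]
proof (induction rule: rtranclp_induct)
  case base
  then show ?case by (rule linked_refl)
next
  case (step v w)
  then obtain e where "e \<in> Y" "en e = {v, w}" by blast
  then have "linked en X v w" using assms(1) edge_closure_iff[of en e v w X] by blast
  then show ?case using step.IH linked_trans by metis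
qed

lemma linked_mono: "X \<subseteq> Y \<Longrightarrow> linked en X u v \<Longrightarrow> linked en Y u v"
  unfolding linked_def by (erule rtranclp_mono[THEN predicate2D, rotated]) blast

text \<open>A walk may cross the new edge many times, but for connectivity a single crossing, in one
  of the two directions, is enough.\<close>

lemma linked_insert:
  assumes e: "en e = {x, y}"
  shows "linked en (insert e F) u v \<longleftrightarrow>
    linked en F u v \<or> (linked en F u x \<and> linked en F y v) \<or> (linked en F u y \<and> linked en F x v)"
    (is "?L \<longleftrightarrow> ?R v")
proof
  assume ?L
  then show "?R v" unfolding linked_def[of en "insert e F"]
  proof (induction rule: rtranclp_induct)
    case base
    then show ?case by (simp add: linked_refl)
  next
    case (step v w)
    then obtain f where f: "f \<in> insert e F" "en f = {v, w}" by blast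
    show ?case
    proof (cases "f \<in> F")
      case True
      then have "linked en F v w" using f linked_edge by metis
      then show ?thesis using step.IH linked_trans by metis
    next
      case False
      then have "{v, w} = {x, y}" using f e by auto
      then have "v = x \<and> w = y \<or> v = y \<and> w = x" by (auto simp: doubleton_eq_iff)
      then show ?thesis using step.IH linked_refl[of en F] by blast
    qed
  qed
next
  have xy: "linked en (insert e F) x y" using linked_edge[of e "insert e F"] e by simp
  note yx = linked_sym[OF xy]
  have lift: "linked en (insert e F) a b" if "linked en F a b" for a b
    using that by (rule linked_mono[rotated]) blast
  show ?L if "?R v"
    using that
  proof (elim disjE conjE)
    assume "linked en F u x" "linked en F y v"
    then show ?L using linked_trans[OF linked_trans[OF lift xy] lift] by blast
  next
    assume "linked en F u y" "linked en F x v"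
    then show ?L using linked_trans[OF linked_trans[OF lift yx] lift] by blast
  qed (rule lift)
qed

text \<open>No edge of \<open>F\<close> leaves \<open>U\<close>, so a walk that starts in
  \<open>U\<close> uses only edges with all ends in \<open>U\<close>.\<close>

lemma linked_within:
  assumes "linked en F a v" "a \<in> U"
    and U: "\<And>e u w. e \<in> F \<Longrightarrow> en e = {u, w} \<Longrightarrow> u \<in> U \<Longrightarrow> w \<in> U"
  shows "linked en {e \<in> F. en e \<subseteq> U} a v \<and> v \<in> U"
  using assms(1) unfolding linked_def[of en F]
proof (induction rule: rtranclp_induct)
  case base
  then show ?case using assms(2) by (simp add: linked_refl)
next
  case (step v w)
  then obtain f where f: "f \<in> F" "en f = {v, w}" by blast
  have w: "w \<in> U" using U[OF f] step.IH by blast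
  have "linked en {e \<in> F. en e \<subseteq> U} v w"
    using f w step.IH by (intro linked_edge[of f]) auto
  then show ?case using w step.IH linked_trans[of en _ a v w] by blast
qed

lemma acyclic_edges_subset:
  assumes "acyclic_edges en F" "F' \<subseteq> F"
  shows "acyclic_edges en F'"
proof -
  have "edge_closure en (F' - {f}) \<subseteq> edge_closure en (F - {f})" for f
    using assms(2) linked_mono[of "F' - {f}" "F - {f}" en] unfolding edge_closure_def by blast
  then show ?thesis using assms unfolding acyclic_edges_def by blast
qed

text \<open>For exchange: a connection of the ends of \<open>e\<close> that exists only with
  \<open>f\<close> must cross \<open>f\<close>. The two stretches before and after the crossing,
  joined by \<open>e\<close>, connect the ends of \<open>f\<close>.\<close>

lemma closure_matroid_edges:
  assumes "finite E" and pair: "\<And>e. e \<in> E \<Longrightarrow> \<exists>u v. en e = {u, v}"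
  shows "closure_matroid E (edge_closure en)"
proof
  show "finite E" by fact
  show "X \<subseteq> edge_closure en X" if X: "X \<subseteq> E" for X
  proof
    fix e assume "e \<in> X"
    moreover obtain u v where "en e = {u, v}" using pair X \<open>e \<in> X\<close> by (meson subsetD)
    ultimately show "e \<in> edge_closure en X"
      using edge_closure_iff[of en e u v X] linked_edge[of e X en u v] by blast
  qed
  show "edge_closure en Y \<subseteq> edge_closure en X" if "Y \<subseteq> edge_closure en X" for X Y
    using linked_closed[OF that] unfolding edge_closure_def by blast
  fix X e f
  assume "e \<in> E" "f \<in> E" and ef: "e \<in> edge_closure en (insert f X)" "e \<notin> edge_closure en X"
  then obtain u v x y where uv: "en e = {u, v}" and xy: "en f = {x, y}" using pair by meson
  have "(linked en X u x \<and> linked en X y v) \<or> (linked en X u y \<and> linked en X x v)"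
    using ef by (auto simp: edge_closure_iff[of en e, OF uv] linked_insert[of en f, OF xy])
  then have "linked en (insert e X) x y"
    unfolding linked_insert[of en e, OF uv] by (meson linked_sym)
  then show "f \<in> edge_closure en (insert e X)" by (simp add: edge_closure_iff[of en f, OF xy])
qed

section \<open>Counting connected components by edges\<close>

lemma equiv_linked_rel: "equiv V (linked_rel en F V)"
proof (rule equivI)
  show "trans (linked_rel en F V)"
    using linked_trans[of en F] unfolding linked_rel_def trans_def by blast
qed (auto simp: linked_rel_def refl_on_def sym_def linked_refl intro: linked_sym)

text \<open>The new edge merges the classes \<open>?A\<close> and \<open>?B\<close> of its ends and
  leaves every other class as it was.\<close>

lemma card_quotient_linked_insert:
  assumes V: "finite V" and x: "x \<in> V" and y: "y \<in> V" and e: "en e = {x, y}"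
    and nl: "\<not> linked en F x y"
  shows "Suc (card (V // linked_rel en (insert e F) V)) = card (V // linked_rel en F V)"
proof -
  let ?R = "linked_rel en F V"
  let ?R' = "linked_rel en (insert e F) V"
  let ?A = "?R `` {x}" and ?B = "?R `` {y}"
  have eqv: "equiv V ?R" by (rule equiv_linked_rel)
  have AB: "?A \<in> V // ?R" "?B \<in> V // ?R" using x y by (auto intro: quotientI)
  have ne: "?A \<noteq> ?B"
  proof
    assume "?A = ?B"
    then have "(x, y) \<in> ?R" using eqv y by (rule eq_equiv_class)
    then show False using nl by (simp add: linked_rel_def)
  qed
  have cls: "?R' `` {z} = (if z \<in> ?A \<union> ?B then ?A \<union> ?B else ?R `` {z})" if z: "z \<in> V" for z
  proof (cases "z \<in> ?A \<union> ?B")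
    case True
    have "linked en (insert e F) z w \<longleftrightarrow> linked en F x w \<or> linked en F y w" for w
    proof -
      have "linked en F x z \<or> linked en F y z" using True by (auto simp: linked_rel_def)
      then show ?thesis unfolding linked_insert[of en e, OF e] by (meson linked_sym linked_trans)
    qed
    then show ?thesis using True x y z by (auto simp: linked_rel_def)
  next
    case False
    then have "\<not> linked en F z x" "\<not> linked en F z y"
      using x y z by (auto simp: linked_rel_def dest: linked_sym)
    then have "linked en (insert e F) z w \<longleftrightarrow> linked en F z w" for w
      unfolding linked_insert[of en e, OF e] by blast
    then show ?thesis using False by (auto simp: linked_rel_def)
  qed
  have same: "?R `` {z} = ?A \<or> ?R `` {z} = ?B \<longleftrightarrow> z \<in> ?A \<union> ?B" if z: "z \<in> V" for z
    using equiv_class_eq_iff[OF eqv, of x z] equiv_class_eq_iff[OF eqv, of y z] x y z by auto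
  have "V // ?R' = insert (?A \<union> ?B) (V // ?R - {?A, ?B})"
  proof (intro equalityI subsetI)
    fix C assume "C \<in> V // ?R'"
    then obtain z where z: "z \<in> V" "C = ?R' `` {z}" by (auto elim: quotientE)
    then show "C \<in> insert (?A \<union> ?B) (V // ?R - {?A, ?B})"
      using cls[OF z(1)] same[OF z(1)] quotientI[OF z(1), of ?R] by auto
  next
    fix C assume C: "C \<in> insert (?A \<union> ?B) (V // ?R - {?A, ?B})"
    show "C \<in> V // ?R'"
    proof (cases "C = ?A \<union> ?B")
      case True
      have "x \<in> ?A" using eqv x by (rule equiv_class_self)
      then have "?R' `` {x} = ?A \<union> ?B" using cls[OF x] by simp
      then show ?thesis using True quotientI[OF x, of ?R'] by simp
    next
      case False
      then obtain z where z: "z \<in> V" "C = ?R `` {z}" using C by (auto elim: quotientE)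
      then have "?R' `` {z} = C" using cls[OF z(1)] same[OF z(1)] C False by auto
      then show ?thesis using quotientI[OF z(1), of ?R'] by simp
    qed
  qed
  \<comment> \<open>If the merged class were already present, the count would drop by two instead of
    one.\<close>
  moreover have "?A \<union> ?B \<notin> V // ?R - {?A, ?B}"
  proof
    assume "?A \<union> ?B \<in> V // ?R - {?A, ?B}"
    then have "?A \<union> ?B \<in> V // ?R" "?A \<union> ?B \<noteq> ?A" by auto
    moreover have "x \<in> ?A" using eqv x by (rule equiv_class_self)
    ultimately show False using quotient_disj[OF eqv, of "?A \<union> ?B" ?A] AB by blast
  qed
  moreover have fin: "finite (V // ?R)"
    using V by (simp add: quotient_def)
  moreover have "card {?A, ?B} = 2" using ne by simp
  moreover have "card {?A, ?B} \<le> card (V // ?R)" using AB fin by (intro card_mono) auto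
  ultimately show ?thesis
    using AB card_Diff_subset[of "{?A, ?B}" "V // ?R"] by simp
qed

text \<open>Starting from singletons, each edge lowers the number of classes by at most one, and by
  exactly one if it closes no cycle. The inequality bounds connected edge sets from below; the
  equality counts the components of forests.\<close>

lemma card_quotient_linked:
  assumes "finite F" "finite V" "\<And>e. e \<in> F \<Longrightarrow> \<exists>u\<in>V. \<exists>v\<in>V. en e = {u, v}"
  shows "card V \<le> card (V // linked_rel en F V) + card F \<and>
    (acyclic_edges en F \<longrightarrow> card (V // linked_rel en F V) + card F = card V)"
  using assms(1,3)
proof (induction F rule: finite_induct)
  case empty
  have "linked en {} u v \<longleftrightarrow> u = v" for u v
    by (auto simp: linked_def elim: converse_rtranclpE)
  then have "V // linked_rel en {} V = (\<lambda>x. {x}) ` V"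
    by (auto simp: quotient_def linked_rel_def)
  then show ?case by (simp add: card_image)
next
  case (insert e F)
  obtain x y where xy: "x \<in> V" "y \<in> V" "en e = {x, y}" using insert.prems by blast
  have IH: "card V \<le> card (V // linked_rel en F V) + card F"
    "acyclic_edges en F \<Longrightarrow> card (V // linked_rel en F V) + card F = card V"
    using insert.IH insert.prems by blast+
  have acyc: "acyclic_edges en F \<and> \<not> linked en F x y" if "acyclic_edges en (insert e F)"
  proof
    show "acyclic_edges en F" using that by (rule acyclic_edges_subset) blast
    have "insert e F - {e} = F" using insert.hyps by blast
    then show "\<not> linked en F x y"
      using that edge_closure_iff[of en e, OF xy(3)] unfolding acyclic_edges_def by auto
  qed
  show ?case
  proof (cases "linked en F x y")
    case True
    then have "linked en (insert e F) u v \<longleftrightarrow> linked en F u v" for u v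
      unfolding linked_insert[of en e, OF xy(3)] by (meson linked_sym linked_trans)
    then have "linked_rel en (insert e F) V = linked_rel en F V" by (simp add: linked_rel_def)
    then show ?thesis using IH insert.hyps acyc True by auto
  next
    case False
    then show ?thesis
      using card_quotient_linked_insert[OF assms(2) xy False] IH insert.hyps acyc by auto
  qed
qed

text \<open>Edges are inserted one by one into the partition. The hypothesis is
  \<open>m' \<le> k (n' - 1)\<close> written without subtraction, and it rules out the set
  \<open>S\<close> that \<open>augment_or_spanned\<close> yields when an insertion fails.\<close>

theorem nash_williams_arboricity:
  assumes "finite V" "finite E"
    and pair: "\<And>e. e \<in> E \<Longrightarrow> \<exists>u\<in>V. \<exists>v\<in>V. en e = {u, v}"
    and sparse: "\<And>U. U \<subseteq> V \<Longrightarrow> U \<noteq> {} \<Longrightarrow> card {e \<in> E. en e \<subseteq> U} + k \<le> k * card U"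
  shows "\<exists>T. (\<forall>i<k. acyclic_edges en (T i)) \<and> disjoint_family_on T {..<k} \<and> (\<Union>i<k. T i) = E"
proof -
  interpret closure_matroid E "edge_closure en"
    using assms by (intro closure_matroid_edges) blast+
  have indep_eq: "indep X = acyclic_edges en X" for X
    by (simp add: indep_def acyclic_edges_def)
  have no_spanned_set: False
    if P: "indep_partition k T X" and X: "insert e X \<subseteq> E" "e \<notin> X" and S: "S \<subseteq> insert e X" "e \<in> S"
      and span: "\<forall>i<k. S \<subseteq> edge_closure en (T i \<inter> S)" for T X e S
  proof -
    obtain a b where ab: "a \<in> V" "b \<in> V" "en e = {a, b}" using pair X by blast
    \<comment> \<open>\<open>U\<close> is the component of \<open>e\<close> in \<open>S\<close>.
      Since \<open>T i \<inter> S\<close> spans \<open>S\<close>, its part \<open>Q i\<close> inside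
      \<open>U\<close> already connects \<open>U\<close> and has at least \<open>card U - 1\<close>
      edges.\<close>
    define U where "U = {v \<in> V. linked en S a v}"
    define Q where "Q i = {f \<in> T i \<inter> S. en f \<subseteq> U}" for i
    have aU: "a \<in> U" using ab by (simp add: U_def linked_refl)
    have U: "U \<subseteq> V" "U \<noteq> {}" "finite U" using aU assms(1) by (auto simp: U_def)
    have Qsub: "Q i \<subseteq> {f \<in> E. en f \<subseteq> U} - {e}" if "i < k" for i
    proof -
      have "T i \<subseteq> X" using P that by (auto simp: indep_partition_def)
      then show ?thesis using X unfolding Q_def by blast
    qed
    have fin: "finite {f \<in> E. en f \<subseteq> U}" using assms(2) by simp
    have finQ: "finite (Q i)" if "i < k" for i
      using Qsub[OF that] fin finite_subset by blast
    have "card U \<le> 1 + card (Q i)" if i: "i < k" for i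
    proof -
      have lk: "linked en (T i \<inter> S) a v" if "v \<in> U" for v
        using that span i linked_closed[of S en "T i \<inter> S" a v] by (simp add: U_def)
      have U_closed: "w \<in> U" if f: "f \<in> T i \<inter> S" "en f = {v, w}" and v: "v \<in> U" for f v w
      proof -
        have "f \<in> E" using f S X by blast
        then have "w \<in> V" using pair[of f] f by (auto simp: doubleton_eq_iff)
        moreover have "linked en S a w"
          using v f linked_edge[of f S en v w] linked_trans[of en S a v w] by (auto simp: U_def)
        ultimately show ?thesis by (simp add: U_def)
      qed
      have "linked en (Q i) a v" if "v \<in> U" for v
        using linked_within[OF lk[OF that] aU] U_closed unfolding Q_def by blast
      then have "linked en (Q i) u v" if "u \<in> U" "v \<in> U" for u v
        using that by (meson linked_sym linked_trans)
      then have "linked_rel en (Q i) U `` {u} = U" if "u \<in> U" for u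
        using that by (auto simp: linked_rel_def)
      then have "U // linked_rel en (Q i) U = {U}"
        using U(2) by (auto simp: quotient_def)
      moreover have "\<exists>u\<in>U. \<exists>v\<in>U. en f = {u, v}" if "f \<in> Q i" for f
      proof -
        have "f \<in> E" "en f \<subseteq> U" using that Qsub[OF i] by auto
        then show ?thesis using pair[of f] by auto
      qed
      ultimately show ?thesis
        using card_quotient_linked[OF finQ[OF i] U(3), of en] by simp
    qed
    then have "k * card U \<le> (\<Sum>i<k. 1 + card (Q i))"
      using sum_bounded_below[of "{..<k}" "card U" "\<lambda>i. 1 + card (Q i)"] by simp
    also have "\<dots> = k + (\<Sum>i<k. card (Q i))" by (simp only: sum.distrib) simp
    also have "(\<Sum>i<k. card (Q i)) = card (\<Union>i<k. Q i)"
    proof (rule card_UN_disjoint[symmetric])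
      show "\<forall>i\<in>{..<k}. \<forall>j\<in>{..<k}. i \<noteq> j \<longrightarrow> Q i \<inter> Q j = {}"
        using P unfolding indep_partition_def disjoint_family_on_def Q_def by blast
    qed (use finQ in auto)
    also have "card (\<Union>i<k. Q i) \<le> card ({f \<in> E. en f \<subseteq> U} - {e})"
      using Qsub fin by (intro card_mono) auto
    \<comment> \<open>The strict inequality is due to \<open>e\<close>, which lies inside
      \<open>U\<close> but in no \<open>T i\<close>.\<close>
    also have "\<dots> < card {f \<in> E. en f \<subseteq> U}"
    proof (rule card_Diff1_less[OF fin])
      have "linked en S a b" using S ab linked_edge[of e S en a b] by simp
      then show "e \<in> {f \<in> E. en f \<subseteq> U}" using X ab aU by (simp add: U_def)
    qed
    finally show False using sparse[OF U(1,2)] by simp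
  qed
  have "\<exists>T. indep_partition k T X" if "X \<subseteq> E" for X
    using finite_subset[OF that assms(2)] that
  proof (induction rule: finite_induct)
    case empty
    have "indep_partition k (\<lambda>_. {}) {}"
      by (simp add: indep_partition_def indep_def disjoint_family_on_def)
    then show ?case by blast
  next
    case (insert e X)
    then obtain T where "indep_partition k T X" by blast
    then show ?case using augment_or_spanned[of k T X e] no_spanned_set insert by metis
  qed
  then show ?thesis unfolding indep_partition_def indep_eq by blast
qed

section \<open>Paths, cycles and acyclic edge sets\<close>

text \<open>Both uses depend on distinct vertices: closing a path to a cycle, and sliding a pebble
  along a path without disturbing its other arcs.\<close>

lemma distinct_path_of_rtranclp:
  assumes "r\<^sup>*\<^sup>* x y"
  obtains p where "p \<noteq> []" "hd p = x" "last p = y" "distinct p" "successively r p"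
  using assms
proof (induction arbitrary: thesis rule: rtranclp_induct)
  case base
  show ?case by (rule base[of "[x]"]) auto
next
  case (step y z)
  obtain p where p: "p \<noteq> []" "hd p = x" "last p = y" "distinct p" "successively r p"
    using step.IH by blast
  show ?case
  proof (cases "z \<in> set p")
    case True
    then obtain a b where "p = a @ z # b" by (meson split_list)
    then show ?thesis
      using p by (intro step.prems[of "a @ [z]"]) (auto simp: successively_append_iff hd_append)
  next
    case False
    then show ?thesis
      using p step.hyps
      by (intro step.prems[of "p @ [z]"]) (auto simp: successively_append_iff)
  qed
qed

text \<open>The last edge of a cycle is spanned by the others. Conversely, a path joining the ends
  of a spanned edge \<open>f\<close> and avoiding \<open>f\<close> forms a cycle together with
  \<open>f\<close>.\<close>

lemma acyclic_edges_iff_no_cycle: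
  assumes "multigraph G"
  shows "acyclic_edges (ends G) (edges G) \<longleftrightarrow> \<not> (\<exists>vs es. cycle G vs es)"
proof
  assume ac: "acyclic_edges (ends G) (edges G)"
  show "\<not> (\<exists>vs es. cycle G vs es)"
  proof
    assume "\<exists>vs es. cycle G vs es"
    then obtain vs es where c: "cycle G vs es" by blast
    define m where "m = length es - 1"
    have len: "length es = Suc m" "length vs = Suc m"
      using c by (auto simp: cycle_def m_def)
    have d: "distinct es" "set es \<subseteq> edges G" using c by (auto simp: cycle_def)
    have en: "ends G (es ! i) = {vs ! i, vs ! (Suc i mod Suc m)}" if "i < Suc m" for i
      using c that len unfolding cycle_def by metis
    have "linked (ends G) (edges G - {es ! m}) (vs ! 0) (vs ! i)" if "i \<le> m" for i
      using that
    proof (induction i)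
      case 0
      then show ?case by (simp add: linked_refl)
    next
      case (Suc i)
      then have "es ! i \<in> edges G - {es ! m}"
        using d len nth_mem[of i es] by (auto simp: nth_eq_iff_index_eq)
      moreover have "ends G (es ! i) = {vs ! i, vs ! Suc i}" using en[of i] Suc by simp
      ultimately have "linked (ends G) (edges G - {es ! m}) (vs ! i) (vs ! Suc i)"
        by (rule linked_edge)
      then show ?case using Suc linked_trans by (metis Suc_leD)
    qed
    then have "linked (ends G) (edges G - {es ! m}) (vs ! m) (vs ! 0)"
      using linked_sym by (metis order_refl)
    moreover have "ends G (es ! m) = {vs ! m, vs ! 0}" using en[of m] by simp
    ultimately have "es ! m \<in> edge_closure (ends G) (edges G - {es ! m})"
      by (simp add: edge_closure_iff)
    moreover have "es ! m \<in> edges G" using d len by (metis lessI nth_mem subsetD)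
    ultimately show False using ac by (simp add: acyclic_edges_def)
  qed
next
  assume nc: "\<not> (\<exists>vs es. cycle G vs es)"
  show "acyclic_edges (ends G) (edges G)"
    unfolding acyclic_edges_def
  proof (intro ballI notI)
    fix f assume f: "f \<in> edges G" "f \<in> edge_closure (ends G) (edges G - {f})"
    then obtain u v where uv: "ends G f = {u, v}" "linked (ends G) (edges G - {f}) u v"
      by (auto simp: edge_closure_def)
    obtain p where p: "p \<noteq> []" "hd p = u" "last p = v" "distinct p"
      "successively (\<lambda>u v. \<exists>e\<in>edges G - {f}. ends G e = {u, v}) p"
      using distinct_path_of_rtranclp[OF uv(2)[unfolded linked_def]] by blast
    \<comment> \<open>The index of the closing edge \<open>f\<close>. For a loop the path is a
      single vertex, so \<open>m = 0\<close> and \<open>es = [f]\<close>.\<close>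
    define m where "m = length p - 1"
    have len: "length p = Suc m" using p(1) by (simp add: m_def)
    have "\<forall>i<m. \<exists>e. e \<in> edges G - {f} \<and> ends G e = {p ! i, p ! Suc i}"
      using p(5) len unfolding successively_conv_nth by auto
    then obtain g where g: "\<And>i. i < m \<Longrightarrow> g i \<in> edges G - {f} \<and> ends G (g i) = {p ! i, p ! Suc i}"
      by metis
    define es where "es = map g [0..<m] @ [f]"
    have es: "es ! i = (if i < m then g i else f)" if "i \<le> m" for i
      using that by (auto simp: es_def nth_append)
    have lene: "length es = Suc m" by (simp add: es_def)
    have inj: "inj_on g {0..<m}"
    proof (rule inj_onI)
      fix i j assume ij: "i \<in> {0..<m}" "j \<in> {0..<m}" "g i = g j"
      then have "{p ! i, p ! Suc i} = {p ! j, p ! Suc j}" using g[of i] g[of j] by auto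
      then show "i = j" using p(4) ij len by (auto simp: doubleton_eq_iff nth_eq_iff_index_eq)
    qed
    have hdlast: "p ! 0 = u" "p ! m = v" using p len by (auto simp: hd_conv_nth last_conv_nth)
    have en: "ends G (es ! i) = {p ! i, p ! (Suc i mod Suc m)}" if "i < Suc m" for i
    proof (cases "i < m")
      case True
      then show ?thesis using es[of i] g[of i] by simp
    next
      case False
      then have "i = m" using that by simp
      then show ?thesis using es[of m] uv hdlast by (simp add: insert_commute)
    qed
    have ends_sub: "ends G e \<subseteq> vertices G" if "e \<in> edges G" for e
      using assms that by (auto simp: multigraph_def)
    have "set es \<subseteq> edges G" using g f by (auto simp: es_def)
    moreover have "set p \<subseteq> vertices G"
    proof
      fix z assume "z \<in> set p"
      then obtain i where i: "i < Suc m" "z = p ! i" using len by (metis in_set_conv_nth)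
      moreover have "es ! i \<in> edges G"
        using \<open>set es \<subseteq> edges G\<close> i lene nth_mem by (metis subsetD)
      ultimately show "z \<in> vertices G" using en[OF i(1)] ends_sub by blast
    qed
    moreover have "f \<notin> g ` {0..<m}" using g by fastforce
    then have "distinct es" using inj by (simp add: es_def distinct_map)
    ultimately have "cycle G p es"
      using en lene len p(4) by (auto simp: cycle_def)
    then show False using nc by blast
  qed
qed

subsection \<open>Trees and tree-pieces\<close>

lemma multigraph_ends:
  assumes "multigraph G" "e \<in> edges G"
  shows "\<exists>u\<in>vertices G. \<exists>v\<in>vertices G. ends G e = {u, v}"
proof -
  have "ends G e \<subseteq> vertices G" "card (ends G e) = 1 \<or> card (ends G e) = 2"
    using assms by (auto simp: multigraph_def)
  then show ?thesis by (auto simp: card_1_singleton_iff card_2_iff)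
qed

lemma multigraphI:
  assumes "finite (vertices G)" "finite (edges G)"
    "\<And>e. e \<in> edges G \<Longrightarrow> \<exists>u\<in>vertices G. \<exists>v\<in>vertices G. ends G e = {u, v}"
  shows "multigraph G"
  unfolding multigraph_def
proof (intro conjI ballI assms(1,2))
  fix e assume "e \<in> edges G"
  then obtain u v where uv: "u \<in> vertices G" "v \<in> vertices G" "ends G e = {u, v}"
    using assms(3) by blast
  then show "ends G e \<subseteq> vertices G" by simp
  show "card (ends G e) = 1 \<or> card (ends G e) = 2"
    using uv by (cases "u = v") auto
qed

lemma rtranclp_adjacent: "(adjacent G)\<^sup>*\<^sup>* = linked (ends G) (edges G)"
  unfolding linked_def adjacent_def[abs_def] by simp

lemma components_eq: "components G = vertices G // linked_rel (ends G) (edges G) (vertices G)"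
  by (simp add: components_def conn_rel_def linked_rel_def rtranclp_adjacent)

lemma card_components_forest:
  assumes "multigraph H" "acyclic_edges (ends H) (edges H)"
  shows "card (components H) + card (edges H) = card (vertices H)"
  using assms card_quotient_linked[of "edges H" "vertices H" "ends H"] multigraph_ends[OF assms(1)]
  by (auto simp: components_eq multigraph_def)

text \<open>Each tree restricted to \<open>G'\<close> is a forest, where components plus edges equal
  vertices. Summed over the trees, every edge of \<open>G'\<close> counts once and every vertex
  \<open>k\<close> times.\<close>

lemma num_tree_pieces_add_edges:
  assumes D: "lTk_decomposition k l G T" and G': "mg_subgraph G' G"
  shows "num_tree_pieces l T G' + card (edges G') = k * card (vertices G')"
proof -
  have fin: "finite (vertices G')" "finite (edges G')"
    using G' by (auto simp: mg_subgraph_def multigraph_def)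
  have piece: "card (components (graph_inter (T j) G')) + card (edges (T j) \<inter> edges G') =
      card (vertices (T j) \<inter> vertices G')" if j: "j < l" for j
  proof -
    let ?H = "graph_inter (T j) G'"
    have T: "mg_subgraph (T j) G" "multigraph (T j)" "acyclic_edges (ends (T j)) (edges (T j))"
      using D j acyclic_edges_iff_no_cycle by (auto simp: lTk_decomposition_def tree_def)
    have "multigraph ?H"
    proof (rule multigraphI)
      fix e assume "e \<in> edges ?H"
      then have e: "e \<in> edges (T j)" "e \<in> edges G'" by (auto simp: graph_inter_def)
      then have "ends (T j) e = ends G' e" using T G' by (auto simp: mg_subgraph_def)
      then have "ends (T j) e \<subseteq> vertices G'"
        using e(2) G' unfolding mg_subgraph_def multigraph_def by blast
      moreover obtain u v where "u \<in> vertices (T j)" "v \<in> vertices (T j)" "ends (T j) e = {u, v}"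
        using multigraph_ends[OF T(2) e(1)] by blast
      ultimately show "\<exists>u\<in>vertices ?H. \<exists>v\<in>vertices ?H. ends ?H e = {u, v}"
        by (intro bexI[of _ u] bexI[of _ v]) (auto simp: graph_inter_def)
    qed (use fin in \<open>auto simp: graph_inter_def\<close>)
    moreover have "acyclic_edges (ends ?H) (edges ?H)"
      using acyclic_edges_subset[OF T(3)] by (simp add: graph_inter_def)
    ultimately show ?thesis
      using card_components_forest[of ?H] by (simp add: graph_inter_def)
  qed
  have "(\<Sum>j<l. card (edges (T j) \<inter> edges G')) = card (\<Union>j<l. edges (T j) \<inter> edges G')"
  proof (rule card_UN_disjoint[symmetric])
    show "\<forall>i\<in>{..<l}. \<forall>j\<in>{..<l}. i \<noteq> j \<longrightarrow>
        (edges (T i) \<inter> edges G') \<inter> (edges (T j) \<inter> edges G') = {}"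
      using D unfolding lTk_decomposition_def disjoint_family_on_def by blast
  qed (use fin in auto)
  also have "(\<Union>j<l. edges (T j) \<inter> edges G') = (\<Union>j<l. edges (T j)) \<inter> edges G'" by blast
  also have "\<dots> = edges G'" using D G' by (auto simp: lTk_decomposition_def mg_subgraph_def)
  finally have E: "(\<Sum>j<l. card (edges (T j) \<inter> edges G')) = card (edges G')" .
  \<comment> \<open>Double counting of the pairs of a tree index \<open>j\<close> and a vertex of
    \<open>G'\<close> in \<open>T j\<close>.\<close>
  have "(\<Sum>j<l. card (vertices (T j) \<inter> vertices G')) =
      (\<Sum>j<l. \<Sum>v\<in>vertices G'. of_bool (v \<in> vertices (T j)))"
    using fin by (simp add: sum_of_bool_eq Int_commute Int_def conj_commute)
  also have "\<dots> = (\<Sum>v\<in>vertices G'. \<Sum>j<l. of_bool (v \<in> vertices (T j)))"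
    by (rule sum.swap)
  also have "\<dots> = (\<Sum>v\<in>vertices G'. k)"
  proof (rule sum.cong)
    fix v assume "v \<in> vertices G'"
    then have "card {j. j < l \<and> v \<in> vertices (T j)} = k"
      using D G' by (auto simp: lTk_decomposition_def mg_subgraph_def)
    then show "(\<Sum>j<l. of_bool (v \<in> vertices (T j))) = k"
      by (simp add: sum_of_bool_eq Int_def)
  qed simp
  finally have "(\<Sum>j<l. card (vertices (T j) \<inter> vertices G')) = k * card (vertices G')" by simp
  moreover have "(\<Sum>j<l. card (components (graph_inter (T j) G')) + card (edges (T j) \<inter> edges G')) =
      (\<Sum>j<l. card (vertices (T j) \<inter> vertices G'))"
    using piece by simp
  ultimately show ?thesis by (simp add: num_tree_pieces_def sum.distrib E)
qed

text \<open>The trees are the components of the \<open>k\<close> forests, each taken as spanning all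
  vertices. An isolated vertex of a forest is a one-vertex tree, so each vertex lies in one tree per
  forest.\<close>

lemma lTk_decomposition_of_forests:
  assumes G: "multigraph G" and F: "\<And>i. i < k \<Longrightarrow> acyclic_edges (ends G) (F i)"
    and disj: "disjoint_family_on F {..<k}" and un: "(\<Union>i<k. F i) = edges G"
    and card: "card (edges G) + l = k * card (vertices G)"
  shows "\<exists>T. lTk_decomposition k l G T"
proof -
  define V where "V = vertices G"
  define en where "en = ends G"
  define R where "R i = linked_rel en (F i) V" for i
  \<comment> \<open>Tagging classes with the forest index keeps equal vertex sets from different
    forests apart; \<open>h\<close> below numbers these pairs by the indices less than
    \<open>l\<close>.\<close>
  define P where "P = (SIGMA i:{..<k}. V // R i)"
  have finV: "finite V" and finE: "finite (edges G)" using G by (auto simp: V_def multigraph_def)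
  have Fsub: "F i \<subseteq> edges G" if "i < k" for i using un that by blast
  have finF: "finite (F i)" if "i < k" for i using Fsub[OF that] finE finite_subset by blast
  have pair: "\<exists>u\<in>V. \<exists>v\<in>V. en e = {u, v}" if "i < k" "e \<in> F i" for i e
    using multigraph_ends[OF G, of e] Fsub[OF that(1)] that(2) unfolding V_def en_def by blast
  have eqv: "equiv V (R i)" for i unfolding R_def by (rule equiv_linked_rel)
  have finQ: "finite (V // R i)" for i using finV by (simp add: quotient_def)
  have "card P = (\<Sum>i<k. card (V // R i))"
    using finQ by (simp add: P_def)
  moreover have "(\<Sum>i<k. card (V // R i) + card (F i)) = (\<Sum>i<k. card V)"
  proof (rule sum.cong)
    fix i assume "i \<in> {..<k}"
    then show "card (V // R i) + card (F i) = card V"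
      using card_quotient_linked[of "F i" V en] finF finV pair F by (simp add: R_def en_def)
  qed simp
  moreover have "(\<Sum>i<k. card (F i)) = card (edges G)"
    unfolding un[symmetric] using finF disj
    by (intro card_UN_disjoint[symmetric]) (auto simp: disjoint_family_on_def)
  ultimately have "card P = l" using card by (simp add: sum.distrib V_def)
  moreover have "finite P" using finQ by (auto simp: P_def)
  ultimately obtain h where h: "bij_betw h {..<l} P"
    using ex_bij_betw_nat_finite[of P] by (auto simp: atLeast0LessThan)
  define T where "T j = \<lparr>vertices = snd (h j),
      edges = {e \<in> F (fst (h j)). en e \<subseteq> snd (h j)}, ends = en\<rparr>" for j
  have hj: "fst (h j) < k \<and> snd (h j) \<in> V // R (fst (h j))" if "j < l" for j
  proof -
    have "h j \<in> P" using h that by (auto simp: bij_betw_def)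
    then show ?thesis by (auto simp: P_def)
  qed
  have cls: "C \<subseteq> V" "C \<noteq> {}" "\<And>u v. u \<in> C \<Longrightarrow> v \<in> C \<Longrightarrow> linked en (F i) u v"
    "\<And>u v. u \<in> C \<Longrightarrow> v \<in> V \<Longrightarrow> linked en (F i) u v \<Longrightarrow> v \<in> C" if "C \<in> V // R i" for i C
  proof -
    show "C \<subseteq> V" "C \<noteq> {}" using that eqv[of i] in_quotient_imp_subset in_quotient_imp_non_empty by metis+
    show "linked en (F i) u v" if "u \<in> C" "v \<in> C" for u v
      using quotient_eq_iff[OF eqv \<open>C \<in> V // R i\<close> \<open>C \<in> V // R i\<close> that] by (simp add: R_def linked_rel_def)
    show "v \<in> C" if "u \<in> C" "v \<in> V" "linked en (F i) u v" for u v
      using in_quotient_imp_closed[OF eqv \<open>C \<in> V // R i\<close> that(1), of v] that \<open>C \<subseteq> V\<close>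
      by (auto simp: R_def linked_rel_def)
  qed
  have index_unique: "a = b"
    if "a < l" "b < l" "fst (h a) = fst (h b)" "x \<in> snd (h a)" "x \<in> snd (h b)" for a b x
  proof -
    have "snd (h a) \<in> V // R (fst (h a))" "snd (h b) \<in> V // R (fst (h a))"
      using hj[OF that(1)] hj[OF that(2)] that(3) by simp_all
    then have "snd (h a) = snd (h b)" using quotient_disj[OF eqv] that(4,5) by blast
    then have "h a = h b" using that(3) by (simp add: prod_eq_iff)
    then show ?thesis using h that(1,2) by (auto simp: bij_betw_def inj_on_def)
  qed
  have T_tree: "mg_subgraph (T j) G \<and> tree (T j)" if j: "j < l" for j
  proof -
    obtain i C where iC: "h j = (i, C)" by fastforce
    then have i: "i < k" and C: "C \<in> V // R i" using hj[OF j] by auto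
    have Tj: "vertices (T j) = C" "edges (T j) = {e \<in> F i. en e \<subseteq> C}" "ends (T j) = en"
      by (simp_all add: T_def iC)
    have mg: "multigraph (T j)"
    proof (rule multigraphI)
      show "finite (vertices (T j))" using cls(1)[OF C] finV Tj finite_subset by metis
      show "finite (edges (T j))" using finF[OF i] Tj by simp
      fix e assume e: "e \<in> edges (T j)"
      then obtain u v where "en e = {u, v}" using pair[OF i, of e] Tj by auto
      then show "\<exists>u\<in>vertices (T j). \<exists>v\<in>vertices (T j). ends (T j) e = {u, v}"
        using e unfolding Tj by blast
    qed
    have "linked en {e \<in> F i. en e \<subseteq> C} u v" if uv: "u \<in> C" "v \<in> C" for u v
    proof -
      have "b \<in> C" if "e \<in> F i" "en e = {a, b}" "a \<in> C" for e a b
      proof (rule cls(4)[OF C that(3)])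
        show "b \<in> V" using pair[OF i that(1)] that(2) by (auto simp: doubleton_eq_iff)
        show "linked en (F i) a b" using that by (intro linked_edge)
      qed
      then show ?thesis using linked_within[OF cls(3)[OF C uv] uv(1)] by blast
    qed
    then have "mg_connected (T j)"
      using cls(2)[OF C] by (auto simp: mg_connected_def conn_rel_def rtranclp_adjacent Tj)
    moreover have "acyclic_edges (ends (T j)) (edges (T j))"
      using acyclic_edges_subset[OF F[OF i]] by (simp add: Tj en_def)
    ultimately have "tree (T j)"
      using mg acyclic_edges_iff_no_cycle[OF mg] by (simp add: tree_def)
    moreover have "mg_subgraph (T j) G"
      using mg cls(1)[OF C] Fsub[OF i] by (auto simp: mg_subgraph_def Tj V_def en_def)
    ultimately show ?thesis by blast
  qed
  have "(\<Union>j<l. edges (T j)) = edges G"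
  proof (intro equalityI subsetI)
    fix e assume "e \<in> (\<Union>j<l. edges (T j))"
    then show "e \<in> edges G" using T_tree by (auto simp: mg_subgraph_def)
  next
    fix e assume "e \<in> edges G"
    then obtain i where i: "i < k" "e \<in> F i" using un by blast
    obtain u v where uv: "u \<in> V" "v \<in> V" "en e = {u, v}" using pair[OF i] by blast
    have "linked en (F i) u v" using i uv by (intro linked_edge)
    then have "en e \<subseteq> R i `` {u}" using uv by (auto simp: R_def linked_rel_def linked_refl)
    moreover have "(i, R i `` {u}) \<in> P" using i uv by (auto simp: P_def intro: quotientI)
    then obtain j where "j < l" "h j = (i, R i `` {u})"
      using h unfolding bij_betw_def by (metis imageE lessThan_iff)
    ultimately have "j < l" "e \<in> edges (T j)" using i by (simp_all add: T_def)
    then show "e \<in> (\<Union>j<l. edges (T j))" by blast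
  qed
  moreover have "disjoint_family_on (\<lambda>j. edges (T j)) {..<l}"
    unfolding disjoint_family_on_def
  proof (intro ballI impI)
    fix a b assume ab: "a \<in> {..<l}" "b \<in> {..<l}" "a \<noteq> b"
    show "edges (T a) \<inter> edges (T b) = {}"
    proof (rule ccontr)
      assume "edges (T a) \<inter> edges (T b) \<noteq> {}"
      then obtain e where e: "e \<in> F (fst (h a))" "e \<in> F (fst (h b))"
        "en e \<subseteq> snd (h a)" "en e \<subseteq> snd (h b)" by (auto simp: T_def)
      have k: "fst (h a) < k" "fst (h b) < k" using hj ab by auto
      then have eq: "fst (h a) = fst (h b)"
        using disj e(1,2) unfolding disjoint_family_on_def by blast
      obtain x where "x \<in> en e" using pair[OF k(1) e(1)] by auto
      then show False using index_unique[of a b x] ab eq e(3,4) by auto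
    qed
  qed
  moreover have "card {j. j < l \<and> v \<in> vertices (T j)} = k" if v: "v \<in> V" for v
  proof -
    \<comment> \<open>Sending a tree to its forest is a bijection from the trees through
      \<open>v\<close> to the forests, because \<open>v\<close> has exactly one class in
      each.\<close>
    have "bij_betw (fst \<circ> h) {j. j < l \<and> v \<in> vertices (T j)} {..<k}"
    proof (rule bij_betw_imageI)
      show "inj_on (fst \<circ> h) {j. j < l \<and> v \<in> vertices (T j)}"
      proof (rule inj_onI)
        fix a b
        assume a: "a \<in> {j. j < l \<and> v \<in> vertices (T j)}" and b: "b \<in> {j. j < l \<and> v \<in> vertices (T j)}"
          and "(fst \<circ> h) a = (fst \<circ> h) b"
        then show "a = b" by (intro index_unique[of a b v]) (simp_all add: T_def)
      qed
      show "(fst \<circ> h) ` {j. j < l \<and> v \<in> vertices (T j)} = {..<k}"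
      proof (intro equalityI subsetI)
        fix i assume i: "i \<in> {..<k}"
        then have "(i, R i `` {v}) \<in> P" using v by (auto simp: P_def intro: quotientI)
        then obtain j where j: "j < l" "h j = (i, R i `` {v})"
          using h unfolding bij_betw_def by (metis imageE lessThan_iff)
        moreover have "v \<in> R i `` {v}" using eqv v by (rule equiv_class_self)
        ultimately show "i \<in> (fst \<circ> h) ` {j. j < l \<and> v \<in> vertices (T j)}"
          by (intro image_eqI[of _ _ j]) (auto simp: T_def)
      qed (use hj in auto)
    qed
    then show ?thesis using bij_betw_same_card by fastforce
  qed
  ultimately have "lTk_decomposition k l G T"
    using T_tree by (simp add: lTk_decomposition_def V_def)
  then show ?thesis by blast
qed

section \<open>From sparsity to a decomposition\<close>

lemma sparse_card_le:
  assumes "sparse k l G" "mg_subgraph G' G" "edges G' \<noteq> {}"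
  shows "card (edges G') + l \<le> k * card (vertices G')"
proof -
  have "finite (edges G')" using assms(2) by (simp add: mg_subgraph_def multigraph_def)
  then have "card (edges G') \<ge> 1" using assms(3) by (simp add: Suc_le_eq card_gt_0_iff)
  then have "int (card (edges G')) \<le> int k * int (card (vertices G')) - int l"
    using assms(1,2) by (auto simp: sparse_def)
  then have "int (card (edges G') + l) \<le> int (k * card (vertices G'))" by simp
  then show ?thesis by (simp only: of_nat_le_iff)
qed

text \<open>\<open>F\<close> may be any nonempty part of the edges induced by \<open>U\<close>: all
  of them for arboricity, or in the game only those already placed together with the next
  one.\<close>

lemma sparse_card_induced_le:
  assumes "multigraph G" "sparse k l G" "U \<subseteq> vertices G" "F \<subseteq> {e \<in> edges G. ends G e \<subseteq> U}" "F \<noteq> {}"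
  shows "card F + l \<le> k * card U"
proof -
  let ?H = "\<lparr>vertices = U, edges = F, ends = ends G\<rparr>"
  have "multigraph ?H"
    using assms finite_subset[of U "vertices G"] finite_subset[of F "edges G"]
    by (auto simp: multigraph_def)
  then have "mg_subgraph ?H G" using assms(3,4) by (auto simp: mg_subgraph_def)
  then show ?thesis using sparse_card_le[OF assms(2)] assms(5) by fastforce
qed

lemma tight_imp_lTk_decomposition:
  assumes G: "multigraph G" and sp: "sparse k l G" and kl: "k \<le> l"
    and card: "card (edges G) + l = k * card (vertices G)"
  shows "\<exists>T. lTk_decomposition k l G T"
proof -
  have "\<exists>F. (\<forall>i<k. acyclic_edges (ends G) (F i)) \<and> disjoint_family_on F {..<k} \<and> (\<Union>i<k. F i) = edges G"
  proof (rule nash_williams_arboricity[of "vertices G"])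
    fix U assume U: "U \<subseteq> vertices G" "U \<noteq> {}"
    show "card {e \<in> edges G. ends G e \<subseteq> U} + k \<le> k * card U"
    \<comment> \<open>Sparsity says nothing about a set that induces no edge; there the bound only
      needs \<open>U\<close> to be nonempty.\<close>
    proof (cases "{e \<in> edges G. ends G e \<subseteq> U} = {}")
      case True
      have "finite U" using U(1) G finite_subset by (auto simp: multigraph_def)
      then have "card U \<ge> 1" using U(2) by (simp add: Suc_le_eq card_gt_0_iff)
      then have "k * 1 \<le> k * card U" by (intro mult_le_mono) auto
      then show ?thesis unfolding True by simp
    next
      case False
      then show ?thesis using sparse_card_induced_le[OF G sp U(1) order_refl] kl by simp
    qed
  qed (use G multigraph_ends[OF G] in \<open>simp_all add: multigraph_def\<close>)
  then show ?thesis using lTk_decomposition_of_forests[OF G _ _ _ card] by blast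
qed

subsection \<open>The pebble game\<close>

text \<open>A vertex pays one pebble for each arc it becomes the tail of, and gets one back when a
  slide turns that arc around.\<close>

lemma reachable_invariant:
  assumes "reachable k l V s"
  shows "verts s = V \<and> finite (arcs s) \<and> (\<forall>e\<in>arcs s. tail s e \<in> V \<and> head s e \<in> V) \<and>
    (\<forall>v\<in>V. size (vertex_pebbles s v) + card {e \<in> arcs s. tail s e = v} = k)"
  using assms
proof (induction rule: reachable.induct)
  case (initial s)
  then show ?case by (simp add: initial_state_def)
next
  case (add_edge s v w c e)
  let ?out = "\<lambda>x. {e' \<in> insert e (arcs s). ((tail s)(e := v)) e' = x}"
  have "size (remove_pebble c v (vertex_pebbles s) x) + card (?out x) = k" if x: "x \<in> V" for x
  proof (cases "x = v")
    case True
    have "?out x = insert e {e' \<in> arcs s. tail s e' = x}" using add_edge.hyps True by auto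
    moreover have "size (vertex_pebbles s v) = Suc (size (vertex_pebbles s v - {#c#}))"
      using add_edge.hyps by (metis insert_DiffM size_add_mset)
    ultimately show ?thesis using add_edge x True by (auto simp: remove_pebble_def)
  next
    case False
    then have "?out x = {e' \<in> arcs s. tail s e' = x}" using add_edge.hyps by auto
    then show ?thesis using add_edge x False by (auto simp: remove_pebble_def)
  qed
  then show ?case using add_edge by auto
next
  case (pebble_slide s e v w p)
  let ?out = "\<lambda>x. {e' \<in> arcs s. ((tail s)(e := w)) e' = x}"
  let ?old = "\<lambda>x. {e' \<in> arcs s. tail s e' = x}"
  have fin: "finite (?old x)" for x using pebble_slide by simp
  have inv: "size (vertex_pebbles s x) + card (?old x) = k" if "x \<in> V" for x
    using pebble_slide that by blast
  have sz: "size (vertex_pebbles s w) = Suc (size (vertex_pebbles s w - {#p#}))"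
    using pebble_slide.hyps by (metis insert_DiffM size_add_mset)
  have "size (put_pebble (arc_pebble s e) v (remove_pebble p w (vertex_pebbles s)) x) + card (?out x) = k"
    if x: "x \<in> V" for x
  proof (cases "v = w")
    \<comment> \<open>Sliding on a loop merely exchanges a pebble of the vertex with that of the
      loop.\<close>
    case True
    then have "?out x = ?old x" using pebble_slide.hyps by auto
    then show ?thesis using inv[OF x] sz True by (auto simp: put_pebble_def remove_pebble_def)
  next
    case vw: False
    consider "x = v" | "x = w" | "x \<noteq> v" "x \<noteq> w" by blast
    then show ?thesis
    proof cases
      case 1
      then have out: "?out x = ?old x - {e}" and "e \<in> ?old x" using pebble_slide.hyps vw by auto
      then have "card (?old x) = Suc (card (?out x))"
        unfolding out using card_Suc_Diff1[OF fin] by presburger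
      then show ?thesis using inv[OF x] 1 vw by (auto simp: put_pebble_def remove_pebble_def)
    next
      case 2
      then have "?out x = insert e (?old x)" "e \<notin> ?old x" using pebble_slide.hyps vw by auto
      then have "card (?out x) = Suc (card (?old x))" using fin by simp
      then show ?thesis using inv[OF x] 2 vw sz by (auto simp: put_pebble_def remove_pebble_def)
    next
      case 3
      then have "?out x = ?old x" using pebble_slide.hyps by auto
      then show ?thesis using inv[OF x] 3 by (auto simp: put_pebble_def remove_pebble_def)
    qed
  qed
  then show ?case using pebble_slide by auto
qed

definition same_underlying :: "('v, 'e) pebble_state \<Rightarrow> ('v, 'e) pebble_state \<Rightarrow> bool" where
  "same_underlying s s' \<longleftrightarrow> arcs s' = arcs s \<and>
     (\<forall>e\<in>arcs s. {tail s' e, head s' e} = {tail s e, head s e})"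

text \<open>Slides are made from the far end of the path backwards: each takes a pebble from the
  head of an arc, reverses the arc and frees a pebble at its tail. Only numbers of pebbles matter;
  the additive form avoids subtraction and covers the path of one vertex.\<close>

lemma slide_along_path:
  assumes "reachable k l V s" "p \<noteq> []" "distinct p"
    "successively (\<lambda>u v. \<exists>e\<in>arcs s. tail s e = u \<and> head s e = v) p"
    "vertex_pebbles s (last p) \<noteq> {#}"
  shows "\<exists>s'. reachable k l V s' \<and> same_underlying s s' \<and>
    (\<forall>z. size (vertex_pebbles s' z) + of_bool (z = last p) =
         size (vertex_pebbles s z) + of_bool (z = hd p))"
  using assms
proof (induction p arbitrary: s rule: rev_induct)
  case Nil
  then show ?case by simp
next
  case (snoc y q)
  show ?case
  proof (cases "q = []")
    case True
    then show ?thesis using snoc.prems by (intro exI[of _ s]) (simp add: same_underlying_def)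
  next
    case False
    define x where "x = last q"
    have xq: "x \<in> set q" "x \<noteq> y" using False snoc.prems by (auto simp: x_def)
    obtain e where e: "e \<in> arcs s" "tail s e = x" "head s e = y"
      using snoc.prems False by (auto simp: successively_append_iff x_def)
    obtain p where p: "p \<in># vertex_pebbles s y" using snoc.prems by auto
    define s1 where "s1 = s\<lparr> tail := (tail s)(e := y), head := (head s)(e := x),
      vertex_pebbles := put_pebble (arc_pebble s e) x (remove_pebble p y (vertex_pebbles s)),
      arc_pebble := (arc_pebble s)(e := p) \<rparr>"
    have r1: "reachable k l V s1"
      unfolding s1_def using snoc.prems(1) e p by (intro reachable.pebble_slide) auto
    have u1: "same_underlying s s1" using e by (auto simp: same_underlying_def s1_def)
    have "size (vertex_pebbles s y) = Suc (size (vertex_pebbles s y - {#p#}))"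
      using p by (metis insert_DiffM size_add_mset)
    then have sz1: "size (vertex_pebbles s1 z) + of_bool (z = y) =
        size (vertex_pebbles s z) + of_bool (z = x)" for z
      using xq by (auto simp: s1_def put_pebble_def remove_pebble_def)
    have "successively (\<lambda>u v. \<exists>e\<in>arcs s1. tail s1 e = u \<and> head s1 e = v) q"
      unfolding successively_conv_nth
    proof (intro allI impI)
      fix i assume i: "Suc i < length q"
      have "successively (\<lambda>u v. \<exists>e\<in>arcs s. tail s e = u \<and> head s e = v) q"
        using snoc.prems by (simp add: successively_append_iff)
      then obtain f where f: "f \<in> arcs s" "tail s f = q ! i" "head s f = q ! Suc i"
        using i unfolding successively_conv_nth by blast
      \<comment> \<open>The remaining arcs start before \<open>x\<close>, hence differ from the
        reversed arc \<open>e\<close> and keep their direction.\<close>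
      have "q ! i \<noteq> x"
        using snoc.prems(3) i False by (auto simp: x_def last_conv_nth nth_eq_iff_index_eq)
      then have "f \<noteq> e" using f e by auto
      then show "\<exists>e\<in>arcs s1. tail s1 e = q ! i \<and> head s1 e = q ! Suc i"
        using f by (intro bexI[of _ f]) (auto simp: s1_def)
    qed
    moreover have "vertex_pebbles s1 (last q) \<noteq> {#}"
      by (simp add: s1_def put_pebble_def x_def)
    ultimately obtain s' where s': "reachable k l V s'" "same_underlying s1 s'"
      "\<forall>z. size (vertex_pebbles s' z) + of_bool (z = x) =
         size (vertex_pebbles s1 z) + of_bool (z = hd q)"
      using snoc.IH[OF r1] False snoc.prems(3) unfolding x_def by auto
    have "same_underlying s s'" using u1 s'(2) by (auto simp: same_underlying_def)
    moreover have "size (vertex_pebbles s' z) + of_bool (z = y) =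
         size (vertex_pebbles s z) + of_bool (z = hd q)" for z
      using sz1[of z] s'(3)[rule_format, of z] by linarith
    ultimately show ?thesis using s'(1) False by (intro exI[of _ s']) simp
  qed
qed

text \<open>No arc leaves the set \<open>U\<close> of vertices reachable from \<open>{a, b}\<close>, so the pebbles on \<open>U\<close>
  number \<open>k |U|\<close> minus the arcs inside \<open>U\<close>, which is more than \<open>l\<close> by assumption. Hence a
  pebble can be fetched as long as \<open>{a, b}\<close> carries at most \<open>l\<close> of them.\<close>

lemma gather_pebbles:
  assumes s: "reachable k l V s" and V: "finite V" and ab: "a \<in> V" "b \<in> V"
    and room: "\<And>U. \<lbrakk>U \<subseteq> V; a \<in> U; b \<in> U\<rbrakk> \<Longrightarrow>
      card {e \<in> arcs s. {tail s e, head s e} \<subseteq> U} + l + 1 \<le> k * card U"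
  shows "\<exists>s'. reachable k l V s' \<and> same_underlying s s' \<and>
    l + 1 \<le> (\<Sum>x\<in>{a, b}. size (vertex_pebbles s' x))"
proof -
  \<comment> \<open>Pebbles are fetched one at a time; \<open>m\<close> is the number already
    secured on \<open>{a, b}\<close>.\<close>
  have "\<exists>s'. reachable k l V s' \<and> same_underlying s s' \<and>
      m \<le> (\<Sum>x\<in>{a, b}. size (vertex_pebbles s' x))" if "m \<le> l + 1" for m
    using that
  proof (induction m)
    case 0
    then show ?case using s by (intro exI[of _ s]) (simp add: same_underlying_def)
  next
    case (Suc m)
    then obtain s' where s': "reachable k l V s'" "same_underlying s s'"
      "m \<le> (\<Sum>x\<in>{a, b}. size (vertex_pebbles s' x))" by auto
    show ?case
    proof (cases "Suc m \<le> (\<Sum>x\<in>{a, b}. size (vertex_pebbles s' x))")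
      case True
      then show ?thesis using s' by blast
    next
      case False
      then have few: "(\<Sum>x\<in>{a, b}. size (vertex_pebbles s' x)) \<le> l" using Suc.prems by simp
      let ?r = "\<lambda>u v. \<exists>e\<in>arcs s'. tail s' e = u \<and> head s' e = v"
      define U where "U = {v. \<exists>x\<in>{a, b}. ?r\<^sup>*\<^sup>* x v}"
      have inv: "finite (arcs s')" "\<And>e. e \<in> arcs s' \<Longrightarrow> tail s' e \<in> V \<and> head s' e \<in> V"
        "\<And>v. v \<in> V \<Longrightarrow> size (vertex_pebbles s' v) + card {e \<in> arcs s'. tail s' e = v} = k"
        using reachable_invariant[OF s'(1)] by auto
      have U_closed: "head s' e \<in> U" if e: "e \<in> arcs s'" "tail s' e \<in> U" for e
      proof -
        obtain x where x: "x \<in> {a, b}" "?r\<^sup>*\<^sup>* x (tail s' e)" using e(2) unfolding U_def by blast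
        have "?r (tail s' e) (head s' e)" using e(1) by blast
        with x(2) have "?r\<^sup>*\<^sup>* x (head s' e)" by (rule rtranclp.rtrancl_into_rtrancl)
        then show ?thesis using x(1) unfolding U_def by blast
      qed
      have "v \<in> V" if "?r\<^sup>*\<^sup>* x v" "x \<in> V" for x v
        using that by (induction rule: rtranclp_induct) (use inv in auto)
      then have UV: "U \<subseteq> V" using ab unfolding U_def by blast
      have abU: "a \<in> U" "b \<in> U" unfolding U_def by auto
      have finU: "finite U" using UV V finite_subset by blast
      have "(\<Sum>v\<in>U. size (vertex_pebbles s' v)) + (\<Sum>v\<in>U. card {e \<in> arcs s'. tail s' e = v}) = k * card U"
        using inv(3) UV by (simp add: sum.distrib[symmetric] subset_iff)
      moreover have "(\<Sum>v\<in>U. card {e \<in> arcs s'. tail s' e = v}) = card (\<Union>v\<in>U. {e \<in> arcs s'. tail s' e = v})"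
        using inv(1) finU by (intro card_UN_disjoint[symmetric]) auto
      moreover have "(\<Union>v\<in>U. {e \<in> arcs s'. tail s' e = v}) = {e \<in> arcs s'. {tail s' e, head s' e} \<subseteq> U}"
        using U_closed by auto
      moreover have "{e \<in> arcs s'. {tail s' e, head s' e} \<subseteq> U} = {e \<in> arcs s. {tail s e, head s e} \<subseteq> U}"
      proof -
        have "arcs s' = arcs s" "\<And>e. e \<in> arcs s \<Longrightarrow> {tail s' e, head s' e} = {tail s e, head s e}"
          using s'(2) by (auto simp: same_underlying_def)
        then show ?thesis by (intro Collect_cong conj_cong) simp_all
      qed
      ultimately have many: "l + 1 \<le> (\<Sum>v\<in>U. size (vertex_pebbles s' v))"
        using room[OF UV abU] by simp
      have "\<exists>y\<in>U - {a, b}. vertex_pebbles s' y \<noteq> {#}"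
      proof (rule ccontr)
        assume "\<not> (\<exists>y\<in>U - {a, b}. vertex_pebbles s' y \<noteq> {#})"
        then have "(\<Sum>v\<in>U. size (vertex_pebbles s' v)) = (\<Sum>x\<in>{a, b}. size (vertex_pebbles s' x))"
          using finU abU by (intro sum.mono_neutral_right) auto
        then show False using many few by simp
      qed
      then obtain y where y: "y \<in> U" "y \<notin> {a, b}" "vertex_pebbles s' y \<noteq> {#}" by blast
      then obtain x where x: "x \<in> {a, b}" "?r\<^sup>*\<^sup>* x y" unfolding U_def by blast
      obtain p where p: "p \<noteq> []" "hd p = x" "last p = y" "distinct p" "successively ?r p"
        using distinct_path_of_rtranclp[OF x(2)] by blast
      obtain s'' where s'': "reachable k l V s''" "same_underlying s' s''"
        and sz: "\<And>z. size (vertex_pebbles s'' z) + of_bool (z = y) =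
          size (vertex_pebbles s' z) + of_bool (z = x)"
        using slide_along_path[OF s'(1) p(1,4,5)] p(2,3) y(3) by auto
      have "(\<Sum>z\<in>{a, b}. size (vertex_pebbles s'' z)) =
          (\<Sum>z\<in>{a, b}. size (vertex_pebbles s' z) + of_bool (z = x))"
      proof (rule sum.cong)
        fix z assume "z \<in> {a, b}"
        then have "z \<noteq> y" using y(2) by blast
        then show "size (vertex_pebbles s'' z) = size (vertex_pebbles s' z) + of_bool (z = x)"
          using sz[of z] by simp
      qed simp
      also have "\<dots> = (\<Sum>z\<in>{a, b}. size (vertex_pebbles s' z)) + (\<Sum>z\<in>{a, b}. of_bool (z = x))"
        by (rule sum.distrib)
      also have "(\<Sum>z\<in>{a, b}. of_bool (z = x)) = (1 :: nat)"
        using x(1) by (cases "a = b") auto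
      finally have "Suc m \<le> (\<Sum>z\<in>{a, b}. size (vertex_pebbles s'' z))" using s'(3) by simp
      moreover have "same_underlying s s''"
        using s'(2) s''(2) by (auto simp: same_underlying_def)
      ultimately show ?thesis using s''(1) by blast
    qed
  qed
  then show ?thesis by blast
qed

text \<open>The edges can be inserted in any order: the placed edges together with the next one
  always lie in \<open>G\<close>, so sparsity applies to them.\<close>

lemma sparse_imp_pebble_game_graph:
  assumes G: "multigraph G" and sp: "sparse k l G"
  shows "pebble_game_graph k l G"
proof -
  let ?V = "vertices G"
  have finV: "finite ?V" and finE: "finite (edges G)" using G by (auto simp: multigraph_def)
  have "\<exists>s. reachable k l ?V s \<and> arcs s = F \<and> (\<forall>e\<in>F. {tail s e, head s e} = ends G e)"
    if "F \<subseteq> edges G" for F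
    using finite_subset[OF that finE] that
  proof (induction F rule: finite_induct)
    case empty
    let ?s = "\<lparr>verts = ?V, arcs = {}, tail = undefined, head = undefined,
      vertex_pebbles = (\<lambda>_. mset_set {1..k}), arc_pebble = undefined\<rparr> :: ('a, 'b) pebble_state"
    have "initial_state k ?V ?s" by (simp add: initial_state_def)
    then have "reachable k l ?V ?s" by (rule reachable.initial)
    then show ?case by (intro exI[of _ ?s]) simp
  next
    case (insert e F)
    then obtain s where s: "reachable k l ?V s" "arcs s = F"
      "\<forall>e\<in>F. {tail s e, head s e} = ends G e" by auto
    obtain a b where ab: "a \<in> ?V" "b \<in> ?V" "ends G e = {a, b}"
      using multigraph_ends[OF G, of e] insert.prems by auto
    have "\<exists>s'. reachable k l ?V s' \<and> same_underlying s s' \<and>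
        l + 1 \<le> (\<Sum>x\<in>{a, b}. size (vertex_pebbles s' x))"
    proof (rule gather_pebbles[OF s(1) finV ab(1,2)])
      fix U assume U: "U \<subseteq> ?V" "a \<in> U" "b \<in> U"
      have "{e \<in> arcs s. {tail s e, head s e} \<subseteq> U} = {f \<in> F. ends G f \<subseteq> U}"
        unfolding s(2) by (intro Collect_cong conj_cong refl) (simp only: s(3)[rule_format])
      \<comment> \<open>The extra pebble that \<open>gather_pebbles\<close> asks for comes from
        counting \<open>e\<close> itself, which is still to be placed.\<close>
      moreover have "card (insert e {f \<in> F. ends G f \<subseteq> U}) + l \<le> k * card U"
        using insert.prems U ab by (intro sparse_card_induced_le[OF G sp U(1)]) auto
      ultimately show "card {e \<in> arcs s. {tail s e, head s e} \<subseteq> U} + l + 1 \<le> k * card U"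
        using insert.hyps by simp
    qed
    then obtain s' where s': "reachable k l ?V s'" "same_underlying s s'"
      "l + 1 \<le> (\<Sum>x\<in>{a, b}. size (vertex_pebbles s' x))" by blast
    \<comment> \<open>The tail must own a pebble. Of the \<open>l + 1\<close> pebbles at least one
      lies on an end of \<open>e\<close>, and the orientation is chosen accordingly.\<close>
    obtain v w where vw: "{v, w} = {a, b}" "vertex_pebbles s' v \<noteq> {#}"
    proof -
      have "vertex_pebbles s' a \<noteq> {#} \<or> vertex_pebbles s' b \<noteq> {#}"
      proof (rule ccontr)
        assume "\<not> ?thesis"
        then have "(\<Sum>x\<in>{a, b}. size (vertex_pebbles s' x)) = 0" by simp
        then show False using s'(3) by linarith
      qed
      then show ?thesis using that[of a b] that[of b a] by (auto simp: insert_commute)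
    qed
    then obtain c where c: "c \<in># vertex_pebbles s' v" by auto
    have vwV: "v \<in> ?V" "w \<in> ?V" using vw(1) ab by (auto simp: doubleton_eq_iff)
    have arcs': "arcs s' = F" using s'(2) s(2) by (simp add: same_underlying_def)
    let ?t = "s'\<lparr> arcs := insert e (arcs s'), tail := (tail s')(e := v), head := (head s')(e := w),
      vertex_pebbles := remove_pebble c v (vertex_pebbles s'), arc_pebble := (arc_pebble s')(e := c) \<rparr>"
    have "reachable k l ?V ?t"
      using s' vw c vwV arcs' insert.hyps by (intro reachable.add_edge) auto
    moreover have "{tail ?t f, head ?t f} = ends G f" if "f \<in> insert e F" for f
    proof (cases "f = e")
      case True
      then show ?thesis using vw ab by simp
    next
      case False
      then have "f \<in> F" using that by simp
      then have "{tail s' f, head s' f} = ends G f"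
        using s s'(2) by (simp add: same_underlying_def)
      then show ?thesis using False by simp
    qed
    ultimately show ?case using arcs' by (intro exI[of _ ?t]) simp
  qed
  then obtain s where s: "reachable k l ?V s" "arcs s = edges G"
    "\<forall>e\<in>edges G. {tail s e, head s e} = ends G e" by blast
  moreover have "verts s = ?V" using reachable_invariant[OF s(1)] by blast
  ultimately have "same_graph G (underlying_graph s)"
    by (simp add: same_graph_def underlying_graph_def)
  then show ?thesis using s(1) by (auto simp: pebble_game_graph_def)
qed

theorem theorem4:
  fixes G :: "('v, 'e) mgraph" and k l n :: nat
  assumes "multigraph G" and "n = card (vertices G)"
    and "k \<le> l" and "int l \<le> 2 * int k - 1"
  shows "pebble_game_graph k l G \<and> tight k l G \<longleftrightarrow>
    (\<exists>T. proper_lTk_decomposition k l G T) \<and>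
    int (card (edges G)) = int k * int n - int l"
proof
  assume "pebble_game_graph k l G \<and> tight k l G"
  then have sp: "sparse k l G" and card: "int (card (edges G)) = int k * int n - int l"
    using assms(2) by (auto simp: tight_def)
  have "int (card (edges G) + l) = int (k * card (vertices G))" using card assms(2) by simp
  then have "card (edges G) + l = k * card (vertices G)" by (simp only: of_nat_eq_iff)
  then obtain T where T: "lTk_decomposition k l G T"
    using tight_imp_lTk_decomposition[OF assms(1) sp assms(3)] by blast
  have "l \<le> num_tree_pieces l T G'"
    if G': "mg_subgraph G' G" "vertices G' \<noteq> {}" "edges G' \<noteq> {} \<or> l \<le> k" for G'
  proof -
    have pieces: "num_tree_pieces l T G' + card (edges G') = k * card (vertices G')"
      by (rule num_tree_pieces_add_edges[OF T G'(1)])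
    show ?thesis
    \<comment> \<open>Without edges, properness is demanded only for \<open>l \<le> k\<close>, and a
      nonempty vertex set has at least \<open>k\<close> pieces. With an edge it is sparsity,
      rewritten by \<open>pieces\<close>.\<close>
    proof (cases "edges G' = {}")
      case True
      have "finite (vertices G')" using G'(1) by (simp add: mg_subgraph_def multigraph_def)
      then have "1 \<le> card (vertices G')" using G'(2) by (simp add: Suc_le_eq card_gt_0_iff)
      then have "k \<le> k * card (vertices G')" by (cases "card (vertices G')") auto
      moreover have "num_tree_pieces l T G' = k * card (vertices G')" using pieces True by simp
      ultimately show ?thesis using True G'(3) by linarith
    next
      case False
      then show ?thesis using pieces sparse_card_le[OF sp G'(1)] by linarith
    qed
  qed
  then have "proper_lTk_decomposition k l G T"
    using T by (simp add: proper_lTk_decomposition_def)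
  then show "(\<exists>T. proper_lTk_decomposition k l G T) \<and> int (card (edges G)) = int k * int n - int l"
    using card by blast
next
  assume R: "(\<exists>T. proper_lTk_decomposition k l G T) \<and> int (card (edges G)) = int k * int n - int l"
  then obtain T where T: "proper_lTk_decomposition k l G T" by blast
  have "sparse k l G"
    unfolding sparse_def
  proof (intro allI impI)
    fix G' assume G': "mg_subgraph G' G \<and> card (edges G') \<ge> 1"
    then have ne: "edges G' \<noteq> {}" by auto
    then have "vertices G' \<noteq> {}"
      using G' multigraph_ends[of G'] by (auto simp: mg_subgraph_def)
    then have "l \<le> num_tree_pieces l T G'"
      using T G' ne by (auto simp: proper_lTk_decomposition_def)
    moreover have "num_tree_pieces l T G' + card (edges G') = k * card (vertices G')"
      using num_tree_pieces_add_edges[of k l G T] T G' by (auto simp: proper_lTk_decomposition_def)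
    ultimately have "card (edges G') + l \<le> k * card (vertices G')" by simp
    then have "int (card (edges G') + l) \<le> int (k * card (vertices G'))" by (simp only: of_nat_le_iff)
    then show "int (card (edges G')) \<le> int k * int (card (vertices G')) - int l" by simp
  qed
  then show "pebble_game_graph k l G \<and> tight k l G"
    using sparse_imp_pebble_game_graph[OF assms(1)] R assms(2) by (simp add: tight_def)
qed

end
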